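(* Let $T^*$ be Tsirelson's original space. Then $c_0$ does not coarsely embed into $T^*$, and for every $p\in[1,\infty)$, $\ell_p$ does not coarsely embed into $T^*$. Likewise, the unit ball $B_{c_0}$ does not uniformly embed into $T^*$, and for every $p\in[1,\infty)$, the unit ball $B_{\ell_p}$ does not uniformly embed into $T^*$.
   Context: All Banach spaces are real. $c_0$ is the space of real sequences converging to $0$ with the sup-norm; $c_{00}$ is the space of finitely supported real sequences, with unit vectors $(e_i)_{i\ge1}$. $B_X$ is the closed unit ball of $X$ with the norm metric. **Embeddings.** For a map $f:(X,d_X)\to(Y,d_Y)$ between metric spaces put $\rho_f(t)=\inf\{d_Y(f(x),f(y)): d_X(x,y)\ge t\}$ and $\omega_f(t)=\sup\{d_Y(f(x),f(y)): d_X(x,y)\le t\}$, with $\inf\emptyset=+\infty$, $\sup\emptyset=0$. $f$ is a coarse embedding if $\lim_{t\to\infty}\rho_f(t)=\infty$ and $\omega_f(t)<\infty$ for all $t>0$; $f$ is a uniform embedding if $\lim_{t\to0}\omega_f(t)=0$ and $\rho_f(t)>0$ for all $t>0$. $X$ coarsely (uniformly) embeds into $Y$ if such an $f$ exists. **Tsirelson's space.** For finite sets $E,F\subset\mathbb N=\{1,2,\dots\}$ write $E<F$ if $\max E<\min F$, and $n\le E$ if $n\le\min E$. A finite sequence $(E_j)_{j=1}^n$ of nonempty finite subsets of $\mathbb N$ is admissible if $n\le E_1<E_2<\dots<E_n$. For $x=\sum_j\xi_je_j\in c_{00}$ let $E(x)=\sum_{j\in E}\xi_je_j$. Define norms on $c_{00}$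 by $\|x\|_0=\max_j|\xi_j|$ and, for $k\ge1$, $\|x\|_k=\max\big(\|x\|_{k-1},\tfrac12\max\{\sum_{j=1}^n\|E_j(x)\|_{k-1}: (E_j)_{j=1}^n\text{ admissible}\}\big)$, and $\|x\|=\lim_k\|x\|_k$. $T$ is the completion of $(c_{00},\|\cdot\|)$ and $T^*$ (Tsirelson's original space) is its dual. *)

theory Defs
  imports "HOL-Analysis.Analysis"
begin

section \<open>Coarse and uniform embeddings\<close>

text \<open>
  Both moduli take values in \<^typ>\<open>ennreal\<close>, where the infimum of the empty set is
  \<open>\<infinity>\<close> and its supremum is \<open>0\<close>.
\<close>

definition compression_modulus ::
    "'a metric \<Rightarrow> 'b metric \<Rightarrow> ('a \<Rightarrow> 'b) \<Rightarrow> real \<Rightarrow> ennreal" where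
  "compression_modulus X Y f t =
     Inf {ennreal (mdist Y (f x) (f y)) | x y. x \<in> mspace X \<and> y \<in> mspace X \<and> mdist X x y \<ge> t}"

definition expansion_modulus ::
    "'a metric \<Rightarrow> 'b metric \<Rightarrow> ('a \<Rightarrow> 'b) \<Rightarrow> real \<Rightarrow> ennreal" where
  "expansion_modulus X Y f t =
     Sup {ennreal (mdist Y (f x) (f y)) | x y. x \<in> mspace X \<and> y \<in> mspace X \<and> mdist X x y \<le> t}"

definition coarse_embedding :: "'a metric \<Rightarrow> 'b metric \<Rightarrow> ('a \<Rightarrow> 'b) \<Rightarrow> bool" where
  "coarse_embedding X Y f \<longleftrightarrow>
     f \<in> mspace X \<rightarrow> mspace Y \<and>
     (compression_modulus X Y f \<longlongrightarrow> \<infinity>) at_top \<and>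
     (\<forall>t>0. expansion_modulus X Y f t < \<infinity>)"

definition uniform_embedding :: "'a metric \<Rightarrow> 'b metric \<Rightarrow> ('a \<Rightarrow> 'b) \<Rightarrow> bool" where
  "uniform_embedding X Y f \<longleftrightarrow>
     f \<in> mspace X \<rightarrow> mspace Y \<and>
     (expansion_modulus X Y f \<longlongrightarrow> 0) (at_right 0) \<and>
     (\<forall>t>0. compression_modulus X Y f t > 0)"

definition coarsely_embeds :: "'a metric \<Rightarrow> 'b metric \<Rightarrow> bool" where
  "coarsely_embeds X Y \<longleftrightarrow> (\<exists>f. coarse_embedding X Y f)"

definition uniformly_embeds :: "'a metric \<Rightarrow> 'b metric \<Rightarrow> bool" where
  "uniformly_embeds X Y \<longleftrightarrow> (\<exists>f. uniform_embedding X Y f)"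


section \<open>The sequence spaces \<open>c\<^sub>0\<close> and \<open>\<ell>\<^sub>p\<close>\<close>

definition c0_space :: "(nat \<Rightarrow> real) set" where
  "c0_space = {x. x \<longlonglongrightarrow> 0}"

definition sup_norm :: "(nat \<Rightarrow> real) \<Rightarrow> real" where
  "sup_norm x = (SUP i. \<bar>x i\<bar>)"

text \<open>
  A \<^const>\<open>metric\<close> has to be nonnegative on the whole type, and \<^const>\<open>sup_norm\<close> is
  unspecified on unbounded sequences; hence the guard.
\<close>

definition c0_metric :: "(nat \<Rightarrow> real) metric" where
  "c0_metric = metric (c0_space,
     \<lambda>x y. if x \<in> c0_space \<and> y \<in> c0_space then sup_norm (\<lambda>i. x i - y i) else 0)"

definition lp_space :: "real \<Rightarrow> (nat \<Rightarrow> real) set" where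
  "lp_space p = {x. summable (\<lambda>i. \<bar>x i\<bar> powr p)}"

definition lp_norm :: "real \<Rightarrow> (nat \<Rightarrow> real) \<Rightarrow> real" where
  "lp_norm p x = (\<Sum>i. \<bar>x i\<bar> powr p) powr (1 / p)"

definition lp_metric :: "real \<Rightarrow> (nat \<Rightarrow> real) metric" where
  "lp_metric p = metric (lp_space p, \<lambda>x y. lp_norm p (\<lambda>i. x i - y i))"

text \<open>
  \<^const>\<open>metric\<close> is only specified on pairs that form a metric space, so the
  following facts are what gives \<^const>\<open>c0_metric\<close> and \<^const>\<open>lp_metric\<close>
  their intended meaning.
\<close>

lemma c0_bdd_above: "x \<in> c0_space \<Longrightarrow> bdd_above (range (\<lambda>i. \<bar>x i\<bar>))"
  unfolding c0_space_def mem_Collect_eq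
  by (drule convergentI, drule convergent_imp_Bseq) (auto simp: Bseq_def bdd_above_def)

lemma c0_diff: "x \<in> c0_space \<Longrightarrow> y \<in> c0_space \<Longrightarrow> (\<lambda>i. x i - y i) \<in> c0_space"
  unfolding c0_space_def using tendsto_diff[of x 0 sequentially y 0] by simp

lemma abs_le_sup_norm: "x \<in> c0_space \<Longrightarrow> \<bar>x i\<bar> \<le> sup_norm x"
  unfolding sup_norm_def by (rule cSUP_upper) (auto intro: c0_bdd_above)

lemma Metric_space_c0:
  "Metric_space c0_space
     (\<lambda>x y. if x \<in> c0_space \<and> y \<in> c0_space then sup_norm (\<lambda>i. x i - y i) else 0)"
proof
  fix x y :: "nat \<Rightarrow> real"
  show "0 \<le> (if x \<in> c0_space \<and> y \<in> c0_space then sup_norm (\<lambda>i. x i - y i) else 0)"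
    using abs_le_sup_norm[OF c0_diff, of x y 0] by auto
  show "(if x \<in> c0_space \<and> y \<in> c0_space then sup_norm (\<lambda>i. x i - y i) else 0) =
        (if y \<in> c0_space \<and> x \<in> c0_space then sup_norm (\<lambda>i. y i - x i) else 0)"
    unfolding sup_norm_def by (simp add: abs_minus_commute)
  assume xy: "x \<in> c0_space" "y \<in> c0_space"
  have "sup_norm (\<lambda>i. x i - y i) = 0 \<Longrightarrow> x = y"
    using abs_le_sup_norm[OF c0_diff[OF xy]] by (intro ext) (metis abs_le_zero_iff eq_iff_diff_eq_0)
  moreover have "sup_norm (\<lambda>i. y i - y i) = 0"
    unfolding sup_norm_def by simp
  ultimately show "((if x \<in> c0_space \<and> y \<in> c0_space then sup_norm (\<lambda>i. x i - y i) else 0) = 0)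
      = (x = y)"
    using xy by auto
next
  fix x y z :: "nat \<Rightarrow> real"
  assume xyz: "x \<in> c0_space" "y \<in> c0_space" "z \<in> c0_space"
  have "\<bar>x i - z i\<bar> \<le> sup_norm (\<lambda>i. x i - y i) + sup_norm (\<lambda>i. y i - z i)" for i
    using abs_le_sup_norm[OF c0_diff[OF xyz(1,2)], of i]
      abs_le_sup_norm[OF c0_diff[OF xyz(2,3)], of i] by linarith
  then have "sup_norm (\<lambda>i. x i - z i) \<le> sup_norm (\<lambda>i. x i - y i) + sup_norm (\<lambda>i. y i - z i)"
    unfolding sup_norm_def[of "\<lambda>i. x i - z i"] by (intro cSUP_least) auto
  then show "(if x \<in> c0_space \<and> z \<in> c0_space then sup_norm (\<lambda>i. x i - z i) else 0) \<le>
      (if x \<in> c0_space \<and> y \<in> c0_space then sup_norm (\<lambda>i. x i - y i) else 0) +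
      (if y \<in> c0_space \<and> z \<in> c0_space then sup_norm (\<lambda>i. y i - z i) else 0)"
    using xyz by simp
qed

lemma mspace_c0_metric [simp]: "mspace c0_metric = c0_space"
  unfolding c0_metric_def by (rule Metric_space.mspace_metric[OF Metric_space_c0])

lemma mdist_c0_metric:
  "x \<in> c0_space \<Longrightarrow> y \<in> c0_space \<Longrightarrow> mdist c0_metric x y = sup_norm (\<lambda>i. x i - y i)"
  unfolding c0_metric_def by (simp add: Metric_space.mdist_metric[OF Metric_space_c0])

lemma powr_convex_nonneg:
  fixes u v t p :: real
  assumes "u \<ge> 0" "v \<ge> 0" "0 \<le> t" "t \<le> 1" "p \<ge> 1"
  shows "(t * u + (1 - t) * v) powr p \<le> t * u powr p + (1 - t) * v powr p"
proof -
  have scale: "(s * w) powr p \<le> s * w powr p" if "0 \<le> s" "s \<le> 1" "w \<ge> 0" for s w :: real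
  proof -
    have "s powr p \<le> s"
      using powr_mono'[of 1 p s] that \<open>p \<ge> 1\<close> by simp
    then show ?thesis using that by (simp add: powr_mult mult_right_mono)
  qed
  consider "u = 0" | "v = 0" | "u > 0" "v > 0" using assms by linarith
  then show ?thesis
  proof cases
    case 1 then show ?thesis using scale[of "1 - t" v] assms by simp
  next
    case 2 then show ?thesis using scale[of t u] assms by simp
  next
    case 3
    then show ?thesis
      using convex_onD[OF powr_convex[OF \<open>p \<ge> 1\<close>], of "1 - t" u v] assms by simp
  qed
qed

lemma lp_norm_nonneg: "lp_norm p x \<ge> 0"
  unfolding lp_norm_def by simp

lemma lp_norm_powr:
  assumes "p \<ge> 1" "x \<in> lp_space p"
  shows "lp_norm p x powr p = (\<Sum>i. \<bar>x i\<bar> powr p)"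
  using assms unfolding lp_norm_def lp_space_def
  by (simp add: powr_powr suminf_nonneg)

lemma lp_norm_eq_0:
  assumes "p \<ge> 1" "x \<in> lp_space p" "lp_norm p x = 0"
  shows "x i = 0"
proof -
  have "(\<Sum>i. \<bar>x i\<bar> powr p) = 0"
    unfolding lp_norm_powr[OF assms(1,2), symmetric] assms(3) by simp
  moreover have "summable (\<lambda>i. \<bar>x i\<bar> powr p)" using assms(2) by (simp add: lp_space_def)
  ultimately have "\<forall>i. \<bar>x i\<bar> powr p = 0"
    by (subst (asm) suminf_eq_zero_iff) simp_all
  then show ?thesis by simp
qed

lemma lp_minkowski:
  assumes p: "p \<ge> 1" and x: "x \<in> lp_space p" and y: "y \<in> lp_space p"
  shows "(\<lambda>i. x i + y i) \<in> lp_space p"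
    and "lp_norm p (\<lambda>i. x i + y i) \<le> lp_norm p x + lp_norm p y"
proof -
  define a b where "a = lp_norm p x" and "b = lp_norm p y"
  have sx: "summable (\<lambda>i. \<bar>x i\<bar> powr p)" and sy: "summable (\<lambda>i. \<bar>y i\<bar> powr p)"
    using x y by (auto simp: lp_space_def)
  have "(\<lambda>i. x i + y i) \<in> lp_space p \<and> lp_norm p (\<lambda>i. x i + y i) \<le> a + b"
  proof (cases "a = 0 \<or> b = 0")
    case True
    then consider "x = (\<lambda>_. 0)" | "y = (\<lambda>_. 0)"
      using lp_norm_eq_0[OF p x] lp_norm_eq_0[OF p y] unfolding a_def b_def by blast
    then show ?thesis
      using x y lp_norm_nonneg[of p x] lp_norm_nonneg[of p y]
      by cases (auto simp: a_def b_def)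
  next
    case False
    then have ab: "a > 0" "b > 0"
      using lp_norm_nonneg[of p x] lp_norm_nonneg[of p y] unfolding a_def b_def by auto
    define t where "t = a / (a + b)"
    have t: "0 \<le> t" "t \<le> 1" "1 - t = b / (a + b)"
      using ab by (auto simp: t_def field_simps)
    define g where "g i = (a + b) powr p * (t * (\<bar>x i\<bar> powr p / a powr p)
        + (1 - t) * (\<bar>y i\<bar> powr p / b powr p))" for i
    have le: "\<bar>x i + y i\<bar> powr p \<le> g i" for i
    proof -
      have "\<bar>x i\<bar> = (a + b) * (t * (\<bar>x i\<bar> / a))" "\<bar>y i\<bar> = (a + b) * ((1 - t) * (\<bar>y i\<bar> / b))"
        using ab unfolding t(3) by (simp_all add: t_def)
      then have "\<bar>x i + y i\<bar> \<le> (a + b) * (t * (\<bar>x i\<bar> / a) + (1 - t) * (\<bar>y i\<bar> / b))"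
        unfolding distrib_left using abs_triangle_ineq[of "x i" "y i"] by linarith
      then have "\<bar>x i + y i\<bar> powr p
          \<le> ((a + b) * (t * (\<bar>x i\<bar> / a) + (1 - t) * (\<bar>y i\<bar> / b))) powr p"
        using p by (intro powr_mono2) auto
      also have "\<dots> = (a + b) powr p * (t * (\<bar>x i\<bar> / a) + (1 - t) * (\<bar>y i\<bar> / b)) powr p"
        by (rule powr_mult)
      also have "\<dots> \<le> (a + b) powr p *
          (t * (\<bar>x i\<bar> / a) powr p + (1 - t) * (\<bar>y i\<bar> / b) powr p)"
        using ab t p by (intro mult_left_mono powr_convex_nonneg) auto
      also have "\<dots> = g i"
        using ab by (simp add: g_def powr_divide)
      finally show ?thesis .
    qed
    have g_sums: "g sums ((a + b) powr p * (t * (a powr p / a powr p)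
        + (1 - t) * (b powr p / b powr p)))"
      unfolding g_def a_def b_def lp_norm_powr[OF p x] lp_norm_powr[OF p y]
      by (intro sums_mult sums_add sums_divide summable_sums sx sy)
    have s: "summable (\<lambda>i. \<bar>x i + y i\<bar> powr p)"
      by (rule summable_comparison_test[OF _ sums_summable[OF g_sums]]) (use le in auto)
    then have in_lp: "(\<lambda>i. x i + y i) \<in> lp_space p" by (simp add: lp_space_def)
    have "(\<Sum>i. \<bar>x i + y i\<bar> powr p) \<le> (a + b) powr p"
      using suminf_le[OF le s sums_summable[OF g_sums]] sums_unique[OF g_sums] ab by simp
    then have "lp_norm p (\<lambda>i. x i + y i) \<le> ((a + b) powr p) powr (1 / p)"
      unfolding lp_norm_def using p s by (intro powr_mono2) (auto intro: suminf_nonneg)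
    then show ?thesis using in_lp p ab by (simp add: powr_powr)
  qed
  then show "(\<lambda>i. x i + y i) \<in> lp_space p"
    and "lp_norm p (\<lambda>i. x i + y i) \<le> lp_norm p x + lp_norm p y"
    by (auto simp: a_def b_def)
qed

lemma lp_diff:
  assumes "p \<ge> 1" "x \<in> lp_space p" "y \<in> lp_space p"
  shows "(\<lambda>i. x i - y i) \<in> lp_space p"
  using lp_minkowski(1)[of p x "\<lambda>i. - y i"] assms by (simp add: lp_space_def)

lemma Metric_space_lp:
  assumes p: "p \<ge> 1"
  shows "Metric_space (lp_space p) (\<lambda>x y. lp_norm p (\<lambda>i. x i - y i))"
proof
  fix x y :: "nat \<Rightarrow> real"
  show "0 \<le> lp_norm p (\<lambda>i. x i - y i)" by (rule lp_norm_nonneg)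
  show "lp_norm p (\<lambda>i. x i - y i) = lp_norm p (\<lambda>i. y i - x i)"
    unfolding lp_norm_def by (simp add: abs_minus_commute)
  assume xy: "x \<in> lp_space p" "y \<in> lp_space p"
  show "(lp_norm p (\<lambda>i. x i - y i) = 0) = (x = y)"
  proof
    assume "lp_norm p (\<lambda>i. x i - y i) = 0"
    then show "x = y"
      using lp_norm_eq_0[OF p lp_diff[OF p xy]] by (intro ext) simp
  qed (use p in \<open>simp add: lp_norm_def\<close>)
next
  fix x y z :: "nat \<Rightarrow> real"
  assume "x \<in> lp_space p" "y \<in> lp_space p" "z \<in> lp_space p"
  then show "lp_norm p (\<lambda>i. x i - z i)
      \<le> lp_norm p (\<lambda>i. x i - y i) + lp_norm p (\<lambda>i. y i - z i)"
    using lp_minkowski(2)[OF p lp_diff[OF p, of x y] lp_diff[OF p, of y z]] by simp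
qed

lemma mspace_lp_metric [simp]: "p \<ge> 1 \<Longrightarrow> mspace (lp_metric p) = lp_space p"
  unfolding lp_metric_def by (rule Metric_space.mspace_metric[OF Metric_space_lp])

lemma mdist_lp_metric:
  "p \<ge> 1 \<Longrightarrow> mdist (lp_metric p) x y = lp_norm p (\<lambda>i. x i - y i)"
  unfolding lp_metric_def by (simp add: Metric_space.mdist_metric[OF Metric_space_lp])


section \<open>Completion of a real normed vector space\<close>

definition null_equiv :: "(nat \<Rightarrow> 'a::real_normed_vector) \<Rightarrow> (nat \<Rightarrow> 'a) \<Rightarrow> bool" where
  "null_equiv X Y \<longleftrightarrow> Cauchy X \<and> Cauchy Y \<and> (\<lambda>n. X n - Y n) \<longlonglongrightarrow> 0"

lemma part_equivp_null_equiv: "part_equivp null_equiv"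
proof (rule part_equivpI)
  have "null_equiv (\<lambda>_. 0::'a) (\<lambda>_. 0)"
    by (simp add: null_equiv_def Cauchy_def)
  then show "\<exists>X::nat \<Rightarrow> 'a. null_equiv X X" by blast
  show "symp (null_equiv :: (nat \<Rightarrow> 'a) \<Rightarrow> _)"
  proof (rule sympI)
    fix X Y :: "nat \<Rightarrow> 'a"
    assume "null_equiv X Y"
    then show "null_equiv Y X"
      unfolding null_equiv_def using tendsto_minus[of "\<lambda>n. X n - Y n" 0] by auto
  qed
  show "transp (null_equiv :: (nat \<Rightarrow> 'a) \<Rightarrow> _)"
  proof (rule transpI)
    fix X Y Z :: "nat \<Rightarrow> 'a"
    assume "null_equiv X Y" "null_equiv Y Z"
    then show "null_equiv X Z"
      unfolding null_equiv_def
      using tendsto_add[of "\<lambda>n. X n - Y n" 0 sequentially "\<lambda>n. Y n - Z n" 0] by auto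
  qed
qed

quotient_type (overloaded) 'a completion =
    "nat \<Rightarrow> 'a::real_normed_vector" / partial: null_equiv
  by (rule part_equivp_null_equiv)

lemma Cauchy_uminus_seq:
  fixes X :: "nat \<Rightarrow> 'a::real_normed_vector"
  shows "Cauchy X \<Longrightarrow> Cauchy (\<lambda>n. - X n)"
  by (rule bounded_linear.Cauchy[OF bounded_linear_minus[OF bounded_linear_ident]])

lemma Cauchy_add_seq:
  fixes X Y :: "nat \<Rightarrow> 'a::real_normed_vector"
  assumes "Cauchy X" "Cauchy Y"
  shows "Cauchy (\<lambda>n. X n + Y n)"
proof (rule metric_CauchyI)
  fix e :: real assume "e > 0"
  then obtain M N where M: "\<forall>m\<ge>M. \<forall>n\<ge>M. dist (X m) (X n) < e / 2"
    and N: "\<forall>m\<ge>N. \<forall>n\<ge>N. dist (Y m) (Y n) < e / 2"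
    using assms unfolding Cauchy_def by (meson half_gt_zero)
  have "dist (X m + Y m) (X n + Y n) < e" if "m \<ge> max M N" "n \<ge> max M N" for m n
  proof -
    have "dist (X m) (X n) < e / 2" "dist (Y m) (Y n) < e / 2" using M N that by auto
    then show ?thesis using dist_triangle_add[of "X m" "Y m" "X n" "Y n"] by linarith
  qed
  then show "\<exists>M. \<forall>m\<ge>M. \<forall>n\<ge>M. dist (X m + Y m) (X n + Y n) < e" by blast
qed

lemma Cauchy_scaleR_seq:
  fixes X :: "nat \<Rightarrow> 'a::real_normed_vector"
  shows "Cauchy X \<Longrightarrow> Cauchy (\<lambda>n. r *\<^sub>R X n)"
  by (rule bounded_linear.Cauchy[OF bounded_linear_scaleR_right])

lemma Cauchy_norm_seq:
  fixes X :: "nat \<Rightarrow> 'a::real_normed_vector"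
  assumes "Cauchy X"
  shows "convergent (\<lambda>n. norm (X n))"
proof (rule Cauchy_convergent, rule metric_CauchyI)
  fix e :: real assume "e > 0"
  then obtain M where "\<forall>m\<ge>M. \<forall>n\<ge>M. dist (X m) (X n) < e"
    using assms unfolding Cauchy_def by blast
  then have "\<forall>m\<ge>M. \<forall>n\<ge>M. dist (norm (X m)) (norm (X n)) < e"
    unfolding dist_norm real_norm_def by (meson le_less_trans norm_triangle_ineq3)
  then show "\<exists>M. \<forall>m\<ge>M. \<forall>n\<ge>M. dist (norm (X m)) (norm (X n)) < e" by blast
qed

instantiation completion :: (real_normed_vector) real_normed_vector
begin

lift_definition zero_completion :: "'a completion" is "\<lambda>_. 0"
  by (simp add: null_equiv_def Cauchy_def)

lift_definition plus_completion :: "'a completion \<Rightarrow> 'a completion \<Rightarrow> 'a completion"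
  is "\<lambda>X Y n. X n + Y n"
  unfolding null_equiv_def by (simp add: Cauchy_add_seq add_diff_add tendsto_add_zero)

lift_definition uminus_completion :: "'a completion \<Rightarrow> 'a completion"
  is "\<lambda>X n. - X n"
proof -
  fix X Y :: "nat \<Rightarrow> 'a"
  assume "null_equiv X Y"
  then show "null_equiv (\<lambda>n. - X n) (\<lambda>n. - Y n)"
    using tendsto_minus[of "\<lambda>n. X n - Y n" 0 sequentially]
    by (simp add: null_equiv_def Cauchy_uminus_seq)
qed

definition minus_completion :: "'a completion \<Rightarrow> 'a completion \<Rightarrow> 'a completion" where
  "minus_completion x y = x + - y"

lift_definition scaleR_completion :: "real \<Rightarrow> 'a completion \<Rightarrow> 'a completion"
  is "\<lambda>r X n. r *\<^sub>R X n"
proof -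
  fix r :: real and X Y :: "nat \<Rightarrow> 'a"
  assume "null_equiv X Y"
  then show "null_equiv (\<lambda>n. r *\<^sub>R X n) (\<lambda>n. r *\<^sub>R Y n)"
    using tendsto_scaleR[OF tendsto_const, of "\<lambda>n. X n - Y n" 0 sequentially r]
    by (simp add: null_equiv_def Cauchy_scaleR_seq scaleR_diff_right)
qed

lift_definition norm_completion :: "'a completion \<Rightarrow> real"
  is "\<lambda>X. lim (\<lambda>n. norm (X n))"
proof -
  fix X Y :: "nat \<Rightarrow> 'a"
  assume XY: "null_equiv X Y"
  then have "Cauchy X" "Cauchy Y" and "(\<lambda>n. norm (X n - Y n)) \<longlonglongrightarrow> 0"
    unfolding null_equiv_def using tendsto_norm_zero by blast+
  from \<open>(\<lambda>n. norm (X n - Y n)) \<longlonglongrightarrow> 0\<close>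
  have "(\<lambda>n. norm (X n) - norm (Y n)) \<longlonglongrightarrow> 0"
    by (rule Lim_null_comparison[rotated])
      (intro always_eventually allI, simp add: norm_triangle_ineq3)
  moreover have "(\<lambda>n. norm (X n) - norm (Y n))
      \<longlonglongrightarrow> lim (\<lambda>n. norm (X n)) - lim (\<lambda>n. norm (Y n))"
    using Cauchy_norm_seq[OF \<open>Cauchy X\<close>] Cauchy_norm_seq[OF \<open>Cauchy Y\<close>]
    by (intro tendsto_diff) (simp_all add: convergent_LIMSEQ_iff)
  ultimately show "lim (\<lambda>n. norm (X n)) = lim (\<lambda>n. norm (Y n))"
    using LIMSEQ_unique by fastforce
qed

definition sgn_completion :: "'a completion \<Rightarrow> 'a completion" where
  "sgn_completion x = scaleR (inverse (norm x)) x"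

definition dist_completion :: "'a completion \<Rightarrow> 'a completion \<Rightarrow> real" where
  "dist_completion x y = norm (x - y)"

definition uniformity_completion :: "('a completion \<times> 'a completion) filter" where
  "uniformity_completion = (INF e\<in>{0<..}. principal {(x, y). dist x y < e})"

definition open_completion :: "'a completion set \<Rightarrow> bool" where
  "open_completion S =
     (\<forall>x\<in>S. \<forall>\<^sub>F (x', y) in uniformity. x' = x \<longrightarrow> y \<in> S)"

instance
proof
  fix x y z :: "'a completion" and a b :: real
  have refl: "null_equiv X X" if "Cauchy X" for X :: "nat \<Rightarrow> 'a"
    using that by (simp add: null_equiv_def)
  show "x + y + z = x + (y + z)"
    by transfer (simp add: null_equiv_def add.assoc Cauchy_add_seq)
  show "x + y = y + x"
    by transfer (simp add: null_equiv_def add.commute Cauchy_add_seq)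
  show "0 + x = x"
    by transfer (simp add: null_equiv_def)
  show "- x + x = 0"
    by transfer (simp add: null_equiv_def Cauchy_def)
  show "x - y = x + - y"
    by (simp add: minus_completion_def)
  show "a *\<^sub>R (x + y) = a *\<^sub>R x + a *\<^sub>R y"
    by transfer (simp add: null_equiv_def scaleR_add_right Cauchy_add_seq Cauchy_scaleR_seq)
  show "(a + b) *\<^sub>R x = a *\<^sub>R x + b *\<^sub>R x"
    by transfer (simp add: null_equiv_def scaleR_add_left Cauchy_add_seq Cauchy_scaleR_seq)
  show "a *\<^sub>R b *\<^sub>R x = (a * b) *\<^sub>R x"
    by transfer (simp add: null_equiv_def Cauchy_scaleR_seq)
  show "1 *\<^sub>R x = x"
    by transfer (simp add: null_equiv_def)
  show "sgn x = scaleR (inverse (norm x)) x"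
    by (simp add: sgn_completion_def)
  show "dist x y = norm (x - y)"
    by (simp add: dist_completion_def)
  show "uniformity = (INF e\<in>{0<..}. principal {(x, y::'a completion). dist x y < e})"
    by (rule uniformity_completion_def)
  show "open U = (\<forall>x\<in>U. \<forall>\<^sub>F (x', y) in uniformity. x' = x \<longrightarrow> y \<in> U)"
    for U :: "'a completion set"
    by (rule open_completion_def)
  show "(norm x = 0) = (x = 0)"
  proof transfer
    fix X :: "nat \<Rightarrow> 'a"
    assume "null_equiv X X"
    then have "Cauchy X" and conv: "(\<lambda>n. norm (X n)) \<longlonglongrightarrow> lim (\<lambda>n. norm (X n))"
      using Cauchy_norm_seq convergent_LIMSEQ_iff by (auto simp: null_equiv_def)
    moreover have "Cauchy (\<lambda>_::nat. 0::'a)" by (simp add: Cauchy_def)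
    ultimately have "null_equiv X (\<lambda>_. 0) \<longleftrightarrow> (\<lambda>n. norm (X n)) \<longlonglongrightarrow> 0"
      by (simp add: null_equiv_def tendsto_norm_zero_iff)
    then show "(lim (\<lambda>n. norm (X n)) = 0) = null_equiv X (\<lambda>_. 0)"
      using conv LIMSEQ_unique by metis
  qed
  show "norm (x + y) \<le> norm x + norm y"
  proof transfer
    fix X Y :: "nat \<Rightarrow> 'a"
    assume "null_equiv X X" "null_equiv Y Y"
    then have "Cauchy X" "Cauchy Y" by (auto simp: null_equiv_def)
    then have "(\<lambda>n. norm (X n)) \<longlonglongrightarrow> lim (\<lambda>n. norm (X n))"
      "(\<lambda>n. norm (Y n)) \<longlonglongrightarrow> lim (\<lambda>n. norm (Y n))"
      "(\<lambda>n. norm (X n + Y n)) \<longlonglongrightarrow> lim (\<lambda>n. norm (X n + Y n))"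
      using Cauchy_norm_seq Cauchy_add_seq convergent_LIMSEQ_iff by blast+
    then show "lim (\<lambda>n. norm (X n + Y n)) \<le> lim (\<lambda>n. norm (X n)) + lim (\<lambda>n. norm (Y n))"
      by (intro LIMSEQ_le[OF _ tendsto_add]) (auto intro: norm_triangle_ineq)
  qed
  show "norm (a *\<^sub>R x) = \<bar>a\<bar> * norm x"
  proof transfer
    fix X :: "nat \<Rightarrow> 'a" and a :: real
    assume "null_equiv X X"
    then have "(\<lambda>n. norm (X n)) \<longlonglongrightarrow> lim (\<lambda>n. norm (X n))"
      using Cauchy_norm_seq convergent_LIMSEQ_iff by (auto simp: null_equiv_def)
    from tendsto_mult_left[OF this, of "\<bar>a\<bar>"]
    show "lim (\<lambda>n. norm (a *\<^sub>R X n)) = \<bar>a\<bar> * lim (\<lambda>n. norm (X n))"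
      by (intro limI) simp
  qed
qed

end

lift_definition to_completion :: "'a::real_normed_vector \<Rightarrow> 'a completion" is "\<lambda>x _. x"
  by (simp add: null_equiv_def Cauchy_def)

text \<open>
  The next facts are the defining properties of a completion: the space embeds linearly and
  isometrically, the image is dense, and the result is a Banach space.
\<close>

lemma linear_to_completion: "linear to_completion"
  by (rule linearI; transfer) (simp_all add: null_equiv_def Cauchy_def)

lemma norm_to_completion [simp]: "norm (to_completion x) = norm x"
  by transfer simp

lemma to_completion_diff: "to_completion (x - y) = to_completion x - to_completion y"
  by (rule linear_diff[OF linear_to_completion])

lemma dist_to_completion [simp]: "dist (to_completion x) (to_completion y) = dist x y"
  by (simp add: dist_norm flip: to_completion_diff)

lemma completion_approx:
  fixes x :: "'a::real_normed_vector completion"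
  obtains X where "Cauchy X" "(\<lambda>n. to_completion (X n)) \<longlonglongrightarrow> x"
    "x = abs_completion X"
proof -
  have "\<exists>X. null_equiv X X \<and> x = abs_completion X"
    by (induct x) blast
  then obtain X where X: "null_equiv X X" "x = abs_completion X" by blast
  then have C: "Cauchy X" by (simp add: null_equiv_def)
  have shift: "norm (to_completion v - x) = lim (\<lambda>n. norm (v - X n))" for v
  proof -
    have Cv: "Cauchy (\<lambda>_::nat. v)" by (simp add: Cauchy_def)
    have "to_completion v - x = abs_completion (\<lambda>n. v + - X n)"
      unfolding minus_completion_def X(2)
      using Cauchy_uminus_seq[OF C] Cv C
      by (subst to_completion.abs_eq uminus_completion.abs_eq plus_completion.abs_eq;
          simp add: null_equiv_def)+
    then show ?thesis
      using Cauchy_add_seq[OF Cv Cauchy_uminus_seq[OF C]]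
      by (simp add: norm_completion.abs_eq null_equiv_def)
  qed
  have "(\<lambda>n. to_completion (X n)) \<longlonglongrightarrow> x"
  proof (rule metric_LIMSEQ_I)
    fix e :: real assume "e > 0"
    then obtain M where M: "\<forall>m\<ge>M. \<forall>n\<ge>M. dist (X m) (X n) < e / 2"
      using C unfolding Cauchy_def by (meson half_gt_zero)
    have "dist (to_completion (X m)) x < e" if "m \<ge> M" for m
    proof -
      have "Cauchy (\<lambda>n. X m - X n)"
        using Cauchy_add_seq[OF _ Cauchy_uminus_seq[OF C], of "\<lambda>_. X m"]
        by (simp add: Cauchy_def)
      then have "(\<lambda>n. norm (X m - X n)) \<longlonglongrightarrow> lim (\<lambda>n. norm (X m - X n))"
        using Cauchy_norm_seq convergent_LIMSEQ_iff by blast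
      then have "lim (\<lambda>n. norm (X m - X n)) \<le> e / 2"
        by (rule LIMSEQ_le_const2) (use M that in \<open>auto simp: dist_norm intro: less_imp_le\<close>)
      then show ?thesis using \<open>e > 0\<close> by (simp add: dist_norm shift)
    qed
    then show "\<exists>no. \<forall>n\<ge>no. dist (to_completion (X n)) x < e" by blast
  qed
  then show ?thesis using that C X(2) by blast
qed

lemma closure_range_to_completion: "closure (range to_completion) = UNIV"
proof -
  have "x \<in> closure (range to_completion)" for x :: "'a completion"
  proof -
    obtain X where "(\<lambda>n. to_completion (X n)) \<longlonglongrightarrow> x"
      by (rule completion_approx)
    then show ?thesis
      unfolding closure_sequential by (intro exI[of _ "\<lambda>n. to_completion (X n)"]) simp
  qed
  then show ?thesis by blast
qed

instance completion :: (real_normed_vector) banach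
proof
  fix Y :: "nat \<Rightarrow> 'a completion"
  assume CY: "Cauchy Y"
  have "\<exists>v. dist (Y n) (to_completion v) < inverse (real (Suc n))" for n
  proof -
    obtain X where "(\<lambda>k. to_completion (X k)) \<longlonglongrightarrow> Y n"
      by (rule completion_approx)
    from metric_LIMSEQ_D[OF this, of "inverse (real (Suc n))"] show ?thesis
      by (metis dist_commute inverse_positive_iff_positive of_nat_0_less_iff order_refl zero_less_Suc)
  qed
  then obtain X where X: "\<And>n. dist (Y n) (to_completion (X n)) < inverse (real (Suc n))"
    by metis
  have d0: "(\<lambda>n. dist (Y n) (to_completion (X n))) \<longlonglongrightarrow> 0"
    by (rule tendsto_sandwich[OF _ _ tendsto_const LIMSEQ_inverse_real_of_nat])
      (intro always_eventually allI zero_le_dist less_imp_le[OF X])+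
  have "Cauchy X"
  proof (rule metric_CauchyI)
    fix e :: real assume e: "e > 0"
    obtain M where M: "\<forall>m\<ge>M. \<forall>n\<ge>M. dist (Y m) (Y n) < e / 3"
      using CY e unfolding Cauchy_def by (meson divide_pos_pos zero_less_numeral)
    obtain N where N: "\<forall>n\<ge>N. dist (Y n) (to_completion (X n)) < e / 3"
      using metric_LIMSEQ_D[OF d0, of "e / 3"] e by auto
    have "dist (X m) (X n) < e" if "m \<ge> max M N" "n \<ge> max M N" for m n
    proof -
      have "dist (Y m) (Y n) < e / 3" "dist (Y m) (to_completion (X m)) < e / 3"
        "dist (Y n) (to_completion (X n)) < e / 3"
        using M N that by auto
      moreover have "dist (X m) (X n) = dist (to_completion (X m)) (to_completion (X n))"
        by simp
      moreover have "\<dots> \<le> dist (Y m) (to_completion (X m)) + dist (Y m) (Y n)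
          + dist (Y n) (to_completion (X n))"
        by metric
      ultimately show ?thesis by linarith
    qed
    then show "\<exists>M. \<forall>m\<ge>M. \<forall>n\<ge>M. dist (X m) (X n) < e" by blast
  qed
  define x where "x = abs_completion X"
  obtain X' where X': "Cauchy X'" "(\<lambda>n. to_completion (X' n)) \<longlonglongrightarrow> x" "x = abs_completion X'"
    by (rule completion_approx)
  have "null_equiv X X'"
    using X'(3) \<open>Cauchy X\<close> X'(1) Quotient3_rel[OF Quotient3_completion, of X X']
    unfolding x_def by (simp add: null_equiv_def)
  then have "(\<lambda>n. to_completion (X n - X' n)) \<longlonglongrightarrow> 0"
    using tendsto_norm_zero_iff[of "\<lambda>n. X n - X' n"]
      tendsto_norm_zero_iff[of "\<lambda>n. to_completion (X n - X' n)"]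
    by (simp add: null_equiv_def)
  from tendsto_add[OF this X'(2)] have X_lim: "(\<lambda>n. to_completion (X n)) \<longlonglongrightarrow> x"
    by (simp add: to_completion_diff)
  have "Y \<longlonglongrightarrow> x"
    by (rule Lim_transform[OF X_lim]) (use d0 in \<open>simp add: dist_norm tendsto_norm_zero_iff\<close>)
  then show "convergent Y" by (rule convergentI)
qed


section \<open>Tsirelson's space and its dual\<close>

definition restrict_coords :: "nat set \<Rightarrow> (nat \<Rightarrow> real) \<Rightarrow> nat \<Rightarrow> real" where
  "restrict_coords E x = (\<lambda>j. if j \<in> E then x j else 0)"

text \<open>
  Coordinates are numbered from \<open>1\<close>, which matters for admissibility; coordinate \<open>0\<close> is
  excluded from the sets here and vanishes on the elements of the type \<open>c00\<close> below.
\<close>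

definition admissible :: "nat set list \<Rightarrow> bool" where
  "admissible Es \<longleftrightarrow> Es \<noteq> [] \<and> (\<forall>E\<in>set Es. finite E \<and> E \<noteq> {} \<and> 0 \<notin> E) \<and>
     length Es \<le> Min (hd Es) \<and> sorted_wrt (\<lambda>E F. Max E < Min F) Es"

primrec tsirelson_norm_approx :: "nat \<Rightarrow> (nat \<Rightarrow> real) \<Rightarrow> real" where
  "tsirelson_norm_approx 0 x = Max (range (\<lambda>j. \<bar>x j\<bar>))"
| "tsirelson_norm_approx (Suc k) x = max (tsirelson_norm_approx k x)
     (1 / 2 * Max {\<Sum>E\<leftarrow>Es. tsirelson_norm_approx k (restrict_coords E x) | Es. admissible Es})"

definition tsirelson_norm :: "(nat \<Rightarrow> real) \<Rightarrow> real" where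
  "tsirelson_norm x = lim (\<lambda>k. tsirelson_norm_approx k x)"

abbreviation fin_supp :: "(nat \<Rightarrow> real) \<Rightarrow> bool" where
  "fin_supp x \<equiv> finite {j. x j \<noteq> 0}"

lemma fin_supp_intros:
  "fin_supp x \<Longrightarrow> fin_supp y \<Longrightarrow> fin_supp (\<lambda>j. x j + y j)"
  "fin_supp x \<Longrightarrow> fin_supp (\<lambda>j. r * x j)"
  "fin_supp x \<Longrightarrow> fin_supp (restrict_coords E x)"
  "fin_supp (\<lambda>_. 0)"
  by (auto simp: restrict_coords_def elim: rev_finite_subset
      intro: finite_subset[of "{j. x j + y j \<noteq> 0}" "{j. x j \<noteq> 0} \<union> {j. y j \<noteq> 0}"])

lemma fin_supp_finite_range:
  assumes "fin_supp x" shows "finite (range (\<lambda>j. \<bar>x j\<bar>))"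
proof (rule finite_subset)
  show "range (\<lambda>j. \<bar>x j\<bar>) \<subseteq> insert 0 ((\<lambda>j. \<bar>x j\<bar>) ` {j. x j \<noteq> 0})" by auto
qed (use assms in auto)

lemma admissible_singleton: "admissible [{1}]"
  by (simp add: admissible_def)

lemma admissible_disjoint:
  fixes E F :: "nat set"
  assumes "sorted_wrt (\<lambda>E F. Max E < Min F) (E # Es)"
    "\<forall>E\<in>set (E # Es). finite E" "F \<in> set Es"
  shows "E \<inter> F = {}"
proof -
  have "Max E < Min F" "finite E" "finite F" using assms by auto
  then have "i < j" if "i \<in> E" "j \<in> F" for i j
    using Max_ge[OF \<open>finite E\<close> that(1)] Min_le[OF \<open>finite F\<close> that(2)] \<open>Max E < Min F\<close> by linarith
  then show ?thesis by blast
qed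

lemma tsirelson_norm_approx_zero: "tsirelson_norm_approx k (\<lambda>_. 0) = 0"
proof (induction k)
  case (Suc k)
  have "(\<Sum>E\<leftarrow>Es. tsirelson_norm_approx k (restrict_coords E (\<lambda>_. 0))) = 0" for Es
    using Suc by (simp add: restrict_coords_def)
  then have "{\<Sum>E\<leftarrow>Es. tsirelson_norm_approx k (restrict_coords E (\<lambda>_. 0)) | Es. admissible Es} = {0}"
    using admissible_singleton by auto
  then show ?case using Suc by simp
qed simp

text \<open>The maximum in the recursion is taken over a finite nonempty set of values.\<close>

lemma finite_admissible_sums:
  assumes "fin_supp x"
  shows "finite {\<Sum>E\<leftarrow>Es. tsirelson_norm_approx k (restrict_coords E x) | Es. admissible Es}"
proof (rule finite_subset)
  define S where "S = {j. x j \<noteq> 0}"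
  define g where "g E = tsirelson_norm_approx k (restrict_coords E x)" for E
  define tr where "tr Es = filter (\<lambda>E. E \<noteq> {}) (map (\<lambda>E. E \<inter> S) Es)" for Es
  have g: "g (E \<inter> S) = g E" for E
    unfolding g_def restrict_coords_def S_def by (rule arg_cong[of _ _ "tsirelson_norm_approx k"]) auto
  have g0: "g {} = 0"
    using tsirelson_norm_approx_zero by (simp add: g_def restrict_coords_def)
  have sum: "sum_list (map g (tr Es)) = sum_list (map g Es)" for Es
  proof (induction Es)
    case (Cons E Es)
    then show ?case using g[of E] g0 by (auto simp: tr_def)
  qed (simp add: tr_def)
  have dist: "distinct (tr Es)"
    if "sorted_wrt (\<lambda>E F. Max E < Min F) Es" "\<forall>E\<in>set Es. finite E" for Es
    using that
  proof (induction Es)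
    case (Cons E Es)
    then have "distinct (tr Es)" by simp
    moreover have "E \<inter> S \<notin> set (tr Es)" if "E \<inter> S \<noteq> {}"
      using admissible_disjoint[OF Cons.prems] that unfolding tr_def by fastforce
    ultimately show ?case by (auto simp: tr_def)
  qed (simp add: tr_def)
  have "set (tr Es) \<subseteq> Pow S" for Es by (auto simp: tr_def)
  then have "sum_list (map g Es) \<in> (\<lambda>L. sum_list (map g L)) ` {L. set L \<subseteq> Pow S \<and> distinct L}"
    if "admissible Es" for Es
    using that sum[of Es] dist[of Es] unfolding admissible_def
    by (intro image_eqI[of _ _ "tr Es"]) auto
  then show "{\<Sum>E\<leftarrow>Es. tsirelson_norm_approx k (restrict_coords E x) | Es. admissible Es}
      \<subseteq> (\<lambda>L. sum_list (map g L)) ` {L. set L \<subseteq> Pow S \<and> distinct L}"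
    unfolding g_def[symmetric] by blast
  show "finite ((\<lambda>L. sum_list (map g L)) ` {L. set L \<subseteq> Pow S \<and> distinct L})"
    using assms unfolding S_def by (intro finite_imageI finite_subset_distinct) auto
qed

lemma admissible_sums_nonempty:
  "{\<Sum>E\<leftarrow>Es. tsirelson_norm_approx k (restrict_coords E x) | Es. admissible Es} \<noteq> {}"
  using admissible_singleton by blast

lemma tsirelson_norm_approx_mono:
  "tsirelson_norm_approx k x \<le> tsirelson_norm_approx (Suc k) x"
  by simp

lemma tsirelson_norm_approx_admissible:
  assumes "fin_supp x" "admissible Es"
  shows "1 / 2 * (\<Sum>E\<leftarrow>Es. tsirelson_norm_approx k (restrict_coords E x))
    \<le> tsirelson_norm_approx (Suc k) x"
proof -
  have "(\<Sum>E\<leftarrow>Es. tsirelson_norm_approx k (restrict_coords E x)) \<le>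
      Max {\<Sum>E\<leftarrow>Es. tsirelson_norm_approx k (restrict_coords E x) | Es. admissible Es}"
    using assms by (intro Max_ge finite_admissible_sums) auto
  then show ?thesis by simp
qed

lemma tsirelson_norm_approx_SucI:
  assumes "fin_supp x" "tsirelson_norm_approx k x \<le> c"
    "\<And>Es. admissible Es \<Longrightarrow>
       1 / 2 * (\<Sum>E\<leftarrow>Es. tsirelson_norm_approx k (restrict_coords E x)) \<le> c"
  shows "tsirelson_norm_approx (Suc k) x \<le> c"
proof -
  have "Max {\<Sum>E\<leftarrow>Es. tsirelson_norm_approx k (restrict_coords E x) | Es. admissible Es}
      \<in> {\<Sum>E\<leftarrow>Es. tsirelson_norm_approx k (restrict_coords E x) | Es. admissible Es}"
    using assms(1) by (intro Max_in finite_admissible_sums admissible_sums_nonempty)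
  then obtain Es where "admissible Es"
    "Max {\<Sum>E\<leftarrow>Es. tsirelson_norm_approx k (restrict_coords E x) | Es. admissible Es}
      = (\<Sum>E\<leftarrow>Es. tsirelson_norm_approx k (restrict_coords E x))"
    by blast
  then show ?thesis using assms(2) assms(3)[of Es] by simp
qed

lemma abs_le_tsirelson_norm_approx:
  assumes "fin_supp x" shows "\<bar>x j\<bar> \<le> tsirelson_norm_approx k x"
proof (induction k)
  case 0
  then show ?case using fin_supp_finite_range[OF assms] by simp
next
  case (Suc k)
  then show ?case using tsirelson_norm_approx_mono[of k x] by linarith
qed

lemma admissible_sum_l1:
  fixes Es :: "nat set list"
  assumes "sorted_wrt (\<lambda>E F. Max E < Min F) Es" "\<forall>E\<in>set Es. finite E"
  shows "(\<Sum>E\<leftarrow>Es. \<Sum>j\<in>E. (f j :: real)) = (\<Sum>j\<in>\<Union>(set Es). f j)"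
  using assms
proof (induction Es)
  case (Cons E Es)
  have "E \<inter> \<Union>(set Es) = {}" using admissible_disjoint[OF Cons.prems] by blast
  then show ?case using Cons by (simp add: sum.union_disjoint)
qed simp

lemma tsirelson_norm_approx_le_l1:
  assumes "fin_supp x"
  shows "tsirelson_norm_approx k x \<le> (\<Sum>j | x j \<noteq> 0. \<bar>x j\<bar>)"
  using assms
proof (induction k arbitrary: x)
  case 0
  have "\<bar>x j\<bar> \<le> (\<Sum>j | x j \<noteq> 0. \<bar>x j\<bar>)" for j
    using 0 by (cases "x j = 0") (auto intro!: sum_nonneg member_le_sum)
  then show ?case
    using fin_supp_finite_range[OF 0] by simp
next
  case (Suc k)
  show ?case
  proof (rule tsirelson_norm_approx_SucI[OF Suc.prems Suc.IH[OF Suc.prems]])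
    fix Es assume Es: "admissible Es"
    have "(\<Sum>E\<leftarrow>Es. tsirelson_norm_approx k (restrict_coords E x)) \<le> (\<Sum>E\<leftarrow>Es. \<Sum>j\<in>E. \<bar>x j\<bar>)"
    proof (rule sum_list_mono)
      fix E assume "E \<in> set Es"
      then have "finite E" using Es by (auto simp: admissible_def)
      have "tsirelson_norm_approx k (restrict_coords E x)
          \<le> (\<Sum>j | restrict_coords E x j \<noteq> 0. \<bar>restrict_coords E x j\<bar>)"
        by (intro Suc.IH fin_supp_intros Suc.prems)
      also have "\<dots> = (\<Sum>j\<in>{j \<in> E. x j \<noteq> 0}. \<bar>x j\<bar>)"
        by (rule sum.cong) (auto simp: restrict_coords_def split: if_splits)
      also have "\<dots> \<le> (\<Sum>j\<in>E. \<bar>x j\<bar>)"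
        using \<open>finite E\<close> by (intro sum_mono2) auto
      finally show "tsirelson_norm_approx k (restrict_coords E x) \<le> (\<Sum>j\<in>E. \<bar>x j\<bar>)" .
    qed
    also have "\<dots> = (\<Sum>j\<in>\<Union>(set Es). \<bar>x j\<bar>)"
      using Es by (intro admissible_sum_l1) (auto simp: admissible_def)
    also have "\<dots> = (\<Sum>j\<in>{j \<in> \<Union>(set Es). x j \<noteq> 0}. \<bar>x j\<bar>)"
      using Es by (intro sum.mono_neutral_right) (auto simp: admissible_def)
    also have "\<dots> \<le> (\<Sum>j | x j \<noteq> 0. \<bar>x j\<bar>)"
      using Suc.prems by (intro sum_mono2) auto
    finally have "(\<Sum>E\<leftarrow>Es. tsirelson_norm_approx k (restrict_coords E x))
        \<le> (\<Sum>j | x j \<noteq> 0. \<bar>x j\<bar>)" .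
    moreover have "0 \<le> (\<Sum>j | x j \<noteq> 0. \<bar>x j\<bar>)" by (intro sum_nonneg) auto
    ultimately show "1 / 2 * (\<Sum>E\<leftarrow>Es. tsirelson_norm_approx k (restrict_coords E x))
        \<le> (\<Sum>j | x j \<noteq> 0. \<bar>x j\<bar>)" by linarith
  qed
qed

lemma tsirelson_norm_approx_triangle:
  assumes "fin_supp x" "fin_supp y"
  shows "tsirelson_norm_approx k (\<lambda>j. x j + y j)
    \<le> tsirelson_norm_approx k x + tsirelson_norm_approx k y"
  using assms
proof (induction k arbitrary: x y)
  case 0
  have "\<bar>x j + y j\<bar> \<le> tsirelson_norm_approx 0 x + tsirelson_norm_approx 0 y" for j
    using abs_le_tsirelson_norm_approx[OF 0(1), of j 0] abs_le_tsirelson_norm_approx[OF 0(2), of j 0]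
    by linarith
  then show ?case
    using fin_supp_finite_range[OF fin_supp_intros(1)[OF 0]]
    by (subst tsirelson_norm_approx.simps(1)) (subst Max_le_iff; auto)
next
  case (Suc k)
  have mono: "tsirelson_norm_approx k z \<le> tsirelson_norm_approx (Suc k) z" for z
    by (rule tsirelson_norm_approx_mono)
  show ?case
  proof (rule tsirelson_norm_approx_SucI)
    show "fin_supp (\<lambda>j. x j + y j)" by (intro fin_supp_intros Suc.prems)
    show "tsirelson_norm_approx k (\<lambda>j. x j + y j)
        \<le> tsirelson_norm_approx (Suc k) x + tsirelson_norm_approx (Suc k) y"
      using Suc.IH[OF Suc.prems] mono[of x] mono[of y] by linarith
    fix Es assume Es: "admissible Es"
    have "(\<Sum>E\<leftarrow>Es. tsirelson_norm_approx k (restrict_coords E (\<lambda>j. x j + y j)))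
        \<le> (\<Sum>E\<leftarrow>Es. tsirelson_norm_approx k (restrict_coords E x)
            + tsirelson_norm_approx k (restrict_coords E y))"
    proof (rule sum_list_mono)
      fix E
      have "restrict_coords E (\<lambda>j. x j + y j) = (\<lambda>j. restrict_coords E x j + restrict_coords E y j)"
        by (auto simp: restrict_coords_def)
      then show "tsirelson_norm_approx k (restrict_coords E (\<lambda>j. x j + y j))
          \<le> tsirelson_norm_approx k (restrict_coords E x)
            + tsirelson_norm_approx k (restrict_coords E y)"
        using Suc.IH[OF fin_supp_intros(3)[OF Suc.prems(1)] fin_supp_intros(3)[OF Suc.prems(2)]]
        by simp
    qed
    then show "1 / 2 * (\<Sum>E\<leftarrow>Es. tsirelson_norm_approx k (restrict_coords E (\<lambda>j. x j + y j)))
        \<le> tsirelson_norm_approx (Suc k) x + tsirelson_norm_approx (Suc k) y"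
      using tsirelson_norm_approx_admissible[OF Suc.prems(1) Es, of k]
        tsirelson_norm_approx_admissible[OF Suc.prems(2) Es, of k]
      unfolding sum_list_addf by linarith
  qed
qed

lemma tsirelson_norm_approx_scale_le:
  assumes "fin_supp x"
  shows "tsirelson_norm_approx k (\<lambda>j. r * x j) \<le> \<bar>r\<bar> * tsirelson_norm_approx k x"
  using assms
proof (induction k arbitrary: x)
  case 0
  have "\<bar>r * x j\<bar> \<le> \<bar>r\<bar> * tsirelson_norm_approx 0 x" for j
    using abs_le_tsirelson_norm_approx[OF 0, of j 0] by (simp add: abs_mult mult_left_mono)
  then show ?case
    using fin_supp_finite_range[OF fin_supp_intros(2)[OF 0]]
    by (subst tsirelson_norm_approx.simps(1)) (subst Max_le_iff; auto)
next
  case (Suc k)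
  show ?case
  proof (rule tsirelson_norm_approx_SucI)
    show "fin_supp (\<lambda>j. r * x j)" by (intro fin_supp_intros Suc.prems)
    show "tsirelson_norm_approx k (\<lambda>j. r * x j) \<le> \<bar>r\<bar> * tsirelson_norm_approx (Suc k) x"
      using Suc.IH[OF Suc.prems] mult_left_mono[OF tsirelson_norm_approx_mono[of k x] abs_ge_zero[of r]]
      by linarith
    fix Es assume Es: "admissible Es"
    have "(\<Sum>E\<leftarrow>Es. tsirelson_norm_approx k (restrict_coords E (\<lambda>j. r * x j)))
        \<le> (\<Sum>E\<leftarrow>Es. \<bar>r\<bar> * tsirelson_norm_approx k (restrict_coords E x))"
    proof (rule sum_list_mono)
      fix E
      have "restrict_coords E (\<lambda>j. r * x j) = (\<lambda>j. r * restrict_coords E x j)"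
        by (auto simp: restrict_coords_def)
      then show "tsirelson_norm_approx k (restrict_coords E (\<lambda>j. r * x j))
          \<le> \<bar>r\<bar> * tsirelson_norm_approx k (restrict_coords E x)"
        using Suc.IH[OF fin_supp_intros(3)[OF Suc.prems]] by simp
    qed
    then show "1 / 2 * (\<Sum>E\<leftarrow>Es. tsirelson_norm_approx k (restrict_coords E (\<lambda>j. r * x j)))
        \<le> \<bar>r\<bar> * tsirelson_norm_approx (Suc k) x"
      using mult_left_mono[OF tsirelson_norm_approx_admissible[OF Suc.prems Es, of k] abs_ge_zero[of r]]
      unfolding sum_list_const_mult by (simp add: algebra_simps)
  qed
qed

lemma tsirelson_norm_approx_scale:
  assumes "fin_supp x"
  shows "tsirelson_norm_approx k (\<lambda>j. r * x j) = \<bar>r\<bar> * tsirelson_norm_approx k x"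
proof (cases "r = 0")
  case True
  then show ?thesis by (simp add: tsirelson_norm_approx_zero)
next
  case False
  have "tsirelson_norm_approx k (\<lambda>j. inverse r * (r * x j))
      \<le> \<bar>inverse r\<bar> * tsirelson_norm_approx k (\<lambda>j. r * x j)"
    by (intro tsirelson_norm_approx_scale_le fin_supp_intros assms)
  then have "\<bar>r\<bar> * tsirelson_norm_approx k x \<le> tsirelson_norm_approx k (\<lambda>j. r * x j)"
    using False by (simp add: field_simps)
  then show ?thesis using tsirelson_norm_approx_scale_le[OF assms, of k r] by linarith
qed

lemma tsirelson_norm_LIMSEQ:
  assumes "fin_supp x"
  shows "(\<lambda>k. tsirelson_norm_approx k x) \<longlonglongrightarrow> tsirelson_norm x"
proof -
  have "incseq (\<lambda>k. tsirelson_norm_approx k x)"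
    by (rule incseq_SucI) (rule tsirelson_norm_approx_mono)
  from incseq_convergent[OF this, of "\<Sum>j | x j \<noteq> 0. \<bar>x j\<bar>"]
  show ?thesis
    unfolding tsirelson_norm_def using tsirelson_norm_approx_le_l1[OF assms] limI by metis
qed

lemma abs_le_tsirelson_norm: "fin_supp x \<Longrightarrow> \<bar>x j\<bar> \<le> tsirelson_norm x"
  by (rule LIMSEQ_le_const[OF tsirelson_norm_LIMSEQ]) (auto intro: abs_le_tsirelson_norm_approx)

lemma tsirelson_norm_zero: "tsirelson_norm (\<lambda>_. 0) = 0"
  by (simp add: tsirelson_norm_def tsirelson_norm_approx_zero)

lemma tsirelson_norm_triangle:
  assumes "fin_supp x" "fin_supp y"
  shows "tsirelson_norm (\<lambda>j. x j + y j) \<le> tsirelson_norm x + tsirelson_norm y"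
  by (rule LIMSEQ_le[OF tsirelson_norm_LIMSEQ[OF fin_supp_intros(1)[OF assms]]
        tendsto_add[OF tsirelson_norm_LIMSEQ[OF assms(1)] tsirelson_norm_LIMSEQ[OF assms(2)]]])
    (auto intro: tsirelson_norm_approx_triangle[OF assms])

lemma tsirelson_norm_scale:
  assumes "fin_supp x"
  shows "tsirelson_norm (\<lambda>j. r * x j) = \<bar>r\<bar> * tsirelson_norm x"
  using tendsto_mult_left[OF tsirelson_norm_LIMSEQ[OF assms], of "\<bar>r\<bar>"]
  unfolding tsirelson_norm_def[of "\<lambda>j. r * x j"] tsirelson_norm_approx_scale[OF assms]
  by (rule limI)

typedef c00 = "{x :: nat \<Rightarrow> real. fin_supp x \<and> x 0 = 0}"
  morphisms coord Abs_c00
  by (rule exI[of _ "\<lambda>_. 0"]) simp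

setup_lifting type_definition_c00

instantiation c00 :: real_normed_vector
begin

lift_definition zero_c00 :: c00 is "\<lambda>_. 0" by simp

lift_definition plus_c00 :: "c00 \<Rightarrow> c00 \<Rightarrow> c00" is "\<lambda>x y j. x j + y j"
  by (simp add: fin_supp_intros)

lift_definition uminus_c00 :: "c00 \<Rightarrow> c00" is "\<lambda>x j. - x j" by simp

lift_definition minus_c00 :: "c00 \<Rightarrow> c00 \<Rightarrow> c00" is "\<lambda>x y j. x j - y j"
  using fin_supp_intros(1)[of _ "\<lambda>j. - _ j"] by simp

lift_definition scaleR_c00 :: "real \<Rightarrow> c00 \<Rightarrow> c00" is "\<lambda>r x j. r * x j"
  by (simp add: fin_supp_intros)

lift_definition norm_c00 :: "c00 \<Rightarrow> real" is tsirelson_norm .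

definition sgn_c00 :: "c00 \<Rightarrow> c00" where
  "sgn_c00 x = scaleR (inverse (norm x)) x"

definition dist_c00 :: "c00 \<Rightarrow> c00 \<Rightarrow> real" where
  "dist_c00 x y = norm (x - y)"

definition uniformity_c00 :: "(c00 \<times> c00) filter" where
  "uniformity_c00 = (INF e\<in>{0<..}. principal {(x, y). dist x y < e})"

definition open_c00 :: "c00 set \<Rightarrow> bool" where
  "open_c00 S = (\<forall>x\<in>S. \<forall>\<^sub>F (x', y) in uniformity. x' = x \<longrightarrow> y \<in> S)"

instance
proof
  fix x y z :: c00 and a b :: real
  show "x + y + z = x + (y + z)" by transfer (simp add: add.assoc)
  show "x + y = y + x" by transfer (simp add: add.commute)
  show "0 + x = x" by transfer simp
  show "- x + x = 0" by transfer simp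
  show "x - y = x + - y" by transfer simp
  show "a *\<^sub>R (x + y) = a *\<^sub>R x + a *\<^sub>R y" by transfer (simp add: algebra_simps)
  show "(a + b) *\<^sub>R x = a *\<^sub>R x + b *\<^sub>R x" by transfer (simp add: algebra_simps)
  show "a *\<^sub>R b *\<^sub>R x = (a * b) *\<^sub>R x" by transfer (simp add: algebra_simps)
  show "1 *\<^sub>R x = x" by transfer simp
  show "sgn x = scaleR (inverse (norm x)) x" by (simp add: sgn_c00_def)
  show "dist x y = norm (x - y)" by (simp add: dist_c00_def)
  show "uniformity = (INF e\<in>{0<..}. principal {(x, y::c00). dist x y < e})"
    by (rule uniformity_c00_def)
  show "open U = (\<forall>x\<in>U. \<forall>\<^sub>F (x', y) in uniformity. x' = x \<longrightarrow> y \<in> U)" for U :: "c00 set"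
    by (rule open_c00_def)
  show "(norm x = 0) = (x = 0)"
  proof transfer
    fix x :: "nat \<Rightarrow> real"
    assume "fin_supp x \<and> x 0 = 0"
    then show "(tsirelson_norm x = 0) = (x = (\<lambda>_. 0))"
      using abs_le_tsirelson_norm[of x] tsirelson_norm_zero by fastforce
  qed
  show "norm (x + y) \<le> norm x + norm y" by transfer (simp add: tsirelson_norm_triangle)
  show "norm (a *\<^sub>R x) = \<bar>a\<bar> * norm x" by transfer (simp add: tsirelson_norm_scale)
qed

end

type_synonym tsirelson = "c00 completion"

type_synonym tsirelson_dual = "tsirelson \<Rightarrow>\<^sub>L real"

text \<open>The metric is the one induced by the operator norm.\<close>

abbreviation tsirelson_dual_metric :: "tsirelson_dual metric" where
  "tsirelson_dual_metric \<equiv> euclidean_metric"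

end

theory Submission
  imports Defs "HOL-Real_Asymp.Real_Asymp"
begin

text \<open>
  The reason for all four statements is one concentration property of \<open>T\<^sup>*\<close>: if a map
  \<open>g\<close> from the Hamming cube \<open>\<nat>\<^sup>k\<close> into \<open>T\<^sup>*\<close> moves by at most \<open>L\<close> when one coordinate of the argument
  changes, then there are points \<open>n\<^sub>1, \<dots>, n\<^sub>k\<close> and \<open>m\<^sub>1, \<dots>, m\<^sub>k\<close> of the cube, all \<open>n\<^sub>i\<close> below all \<open>m\<^sub>j\<close>,
  whose images are at distance at most \<open>2 * L + \<delta>\<close>, with a bound that does not depend on \<open>k\<close>
  (\<open>hamming_lipschitz_concentration\<close>). In \<open>c\<^sub>0\<close> and in \<open>\<ell>\<^sub>p\<close>, by contrast, there are copies of the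
  cubes whose edges have a fixed length while such pairs of points are arbitrarily far apart as
  \<open>k\<close> grows; scaled into the unit ball, the edges become arbitrarily short while the pairs keep
  a fixed distance (\<open>hamming_copy_c0\<close>, \<open>hamming_copy_lp\<close>). Composing a coarse or uniform
  embedding with these cubes bounds its compression modulus at the larger distance by twice its
  expansion modulus at the smaller one (\<open>compression_le_expansion\<close>), a contradiction.

  Concentration rests on two features of Tsirelson's norm. By its definition,
  \<open>n\<close> successive functionals of norm at most \<open>L\<close>, supported beyond \<open>n\<close>, have a sum of norm at most \<open>2 * L\<close>
  (\<open>norm_block_dominated_le\<close>). Moreover the unit vector basis of \<open>T\<close> is shrinking, so that every functional
  is almost finitely supported (\<open>functional_tail_small\<close>); this is the point where \<open>T\<close> does not look like
  \<open>\<ell>\<^sub>1\<close>. Iterated weak* limits of \<open>g\<close> along its last variables split \<open>g ns\<close>, up to a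
  constant, into a sum of \<open>k\<close> increments of norm at most \<open>L\<close>, the \<open>i\<close>-th being weak* null in the \<open>i\<close>-th variable.
  A gliding hump choice of the entries \<open>n\<^sub>1, \<dots>, n\<^sub>k, m\<^sub>1, \<dots>, m\<^sub>k\<close>, one after the other, turns the
  increments of both points into \<open>2 * k\<close> successive blocks beyond \<open>2 * k\<close>.
\<close>

section \<open>Generalised limits and weak* limits\<close>

text \<open>
  Evaluation at \<open>n\<close> turns \<open>n\<close> into a point of a product of compact intervals, one for each bounded
  sequence; Tychonoff's theorem gives these points a cluster point. Approximation along one index
  \<open>n\<close> that serves finitely many sequences simultaneously is what makes the cluster point behave like
  a limit along a free ultrafilter: every relation between finitely many sequences that holds
  termwise passes to their limits.
\<close>

lemma ex_generalised_limit:
  "\<exists>Lm :: (nat \<Rightarrow> real) \<Rightarrow> real. \<forall>F e N. finite F \<longrightarrow> (\<forall>f\<in>F. Bseq f) \<longrightarrow> e > 0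
     \<longrightarrow> (\<exists>n\<ge>N. \<forall>f\<in>F. \<bar>f n - Lm f\<bar> < e)"
proof -
  define B where "B f = (SOME K. \<forall>n. \<bar>f n\<bar> \<le> K)" for f :: "nat \<Rightarrow> real"
  have B: "\<bar>f n\<bar> \<le> B f" if "Bseq f" for f n
  proof -
    have "\<exists>K. \<forall>n. \<bar>f n\<bar> \<le> K" using that by (auto simp: Bseq_def)
    then show ?thesis unfolding B_def by (rule someI2_ex) blast
  qed
  define S where "S f = (if Bseq f then {- B f..B f} else {0})" for f :: "nat \<Rightarrow> real"
  define ev where "ev n = (\<lambda>f :: nat \<Rightarrow> real. if Bseq f then f n else 0)" for n :: nat
  have ev_in: "ev n \<in> PiE UNIV S" for n
    using B[of _ n] by (auto simp: ev_def S_def abs_le_iff PiE_def Pi_def minus_le_iff)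
  have "compactin (product_topology (\<lambda>_. euclidean) UNIV) (PiE UNIV S)"
    unfolding compactin_PiE by (auto simp: S_def)
  then have "compact (PiE UNIV S)"
    by (simp add: euclidean_product_topology)
  then have "\<exists>\<Phi>\<in>PiE UNIV S. inf (nhds \<Phi>) (filtermap ev sequentially) \<noteq> bot"
    unfolding compact_filter by (rule allE[of _ "filtermap ev sequentially"])
      (use ev_in in \<open>auto simp: eventually_filtermap filtermap_bot_iff\<close>)
  then obtain \<Phi> where \<Phi>: "inf (nhds \<Phi>) (filtermap ev sequentially) \<noteq> bot" by blast
  have "\<exists>n\<ge>N. \<forall>f\<in>F. \<bar>f n - \<Phi> f\<bar> < e"
    if F: "finite F" "\<forall>f\<in>F. Bseq f" "e > 0" for F e N
  proof (rule ccontr)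
    assume neg: "\<not> ?thesis"
    have "\<forall>\<^sub>F \<psi> in nhds \<Phi>. \<bar>\<psi> f - \<Phi> f\<bar> < e" for f
    proof -
      have "((\<lambda>\<psi>. \<psi> f) \<longlongrightarrow> \<Phi> f) (nhds \<Phi>)"
        using continuous_on_product_coordinates[of f]
        by (auto simp: continuous_on_def tendsto_nhds_iff)
      from tendstoD[OF this \<open>e > 0\<close>] show ?thesis by (simp add: dist_real_def)
    qed
    then have near: "\<forall>\<^sub>F \<psi> in nhds \<Phi>. \<forall>f\<in>F. \<bar>\<psi> f - \<Phi> f\<bar> < e"
      using F(1) by (simp add: eventually_ball_finite)
    have far: "\<forall>\<^sub>F \<psi> in filtermap ev sequentially. \<not> (\<forall>f\<in>F. \<bar>\<psi> f - \<Phi> f\<bar> < e)"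
      unfolding eventually_filtermap
      using eventually_ge_at_top[of N]
      by (rule eventually_mono) (use neg F(2) in \<open>auto simp: ev_def\<close>)
    have "\<forall>\<^sub>F \<psi> in inf (nhds \<Phi>) (filtermap ev sequentially). False"
      unfolding eventually_inf using near far by blast
    then show False using \<Phi> by (simp add: eventually_False)
  qed
  then show ?thesis by blast
qed

lemma Bseq_add_seqs:
  fixes f g :: "nat \<Rightarrow> real"
  assumes "Bseq f" "Bseq g"
  shows "Bseq (\<lambda>n. f n + g n)"
proof -
  obtain K M where "\<And>n. norm (f n) \<le> K" "\<And>n. norm (g n) \<le> M"
    using assms by (auto simp: Bseq_def)
  then have "norm (f n + g n) \<le> K + M" for n by (meson norm_triangle_mono)
  then show ?thesis by (rule BseqI')
qed

definition generalised_limit :: "(nat \<Rightarrow> real) \<Rightarrow> real" where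
  "generalised_limit = (SOME Lm. \<forall>F e N. finite F \<longrightarrow> (\<forall>f\<in>F. Bseq f) \<longrightarrow> e > 0
     \<longrightarrow> (\<exists>n\<ge>N. \<forall>f\<in>F. \<bar>f n - Lm f\<bar> < e))"

lemma generalised_limit_approx:
  assumes "finite F" "\<forall>f\<in>F. Bseq f" "e > 0"
  obtains n where "n \<ge> N" "\<forall>f\<in>F. \<bar>f n - generalised_limit f\<bar> < e"
  using someI_ex[OF ex_generalised_limit, folded generalised_limit_def] assms by blast

lemma generalised_limit_add:
  assumes "Bseq f" "Bseq g"
  shows "generalised_limit (\<lambda>n. f n + g n) = generalised_limit f + generalised_limit g"
proof (rule ccontr)
  let ?h = "\<lambda>n. f n + g n"
  define e where "e = \<bar>generalised_limit ?h - (generalised_limit f + generalised_limit g)\<bar> / 3"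
  assume "\<not> ?thesis"
  then have "e > 0" by (auto simp: e_def)
  have "Bseq ?h" using assms by (rule Bseq_add_seqs)
  obtain n where "\<forall>k\<in>{f, g, ?h}. \<bar>k n - generalised_limit k\<bar> < e"
    by (rule generalised_limit_approx[of "{f, g, ?h}" e 0]) (use assms \<open>Bseq ?h\<close> \<open>e > 0\<close> in auto)
  then have "\<bar>f n - generalised_limit f\<bar> < e" "\<bar>g n - generalised_limit g\<bar> < e"
    "\<bar>f n + g n - generalised_limit ?h\<bar> < e" by auto
  then have "\<bar>generalised_limit ?h - (generalised_limit f + generalised_limit g)\<bar> < 3 * e"
    by linarith
  then show False by (simp add: e_def)
qed

lemma generalised_limit_mult:
  assumes "Bseq f"
  shows "generalised_limit (\<lambda>n. r * f n) = r * generalised_limit f"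
proof (rule ccontr)
  let ?h = "\<lambda>n. r * f n"
  define e where "e = \<bar>generalised_limit ?h - r * generalised_limit f\<bar> / (2 + \<bar>r\<bar>)"
  assume "\<not> ?thesis"
  then have "e > 0" by (auto simp: e_def)
  have "Bseq ?h" using assms by (rule Bseq_mult[OF Bfun_const])
  obtain n where "\<forall>k\<in>{f, ?h}. \<bar>k n - generalised_limit k\<bar> < e"
    by (rule generalised_limit_approx[of "{f, ?h}" e 0]) (use assms \<open>Bseq ?h\<close> \<open>e > 0\<close> in auto)
  then have n: "\<bar>f n - generalised_limit f\<bar> < e" "\<bar>r * f n - generalised_limit ?h\<bar> < e" by auto
  have "\<bar>r * f n - r * generalised_limit f\<bar> = \<bar>r\<bar> * \<bar>f n - generalised_limit f\<bar>"
    by (simp add: abs_mult flip: right_diff_distrib)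
  also have "\<dots> \<le> \<bar>r\<bar> * e" using n(1) by (intro mult_left_mono) auto
  finally have "\<bar>generalised_limit ?h - r * generalised_limit f\<bar> < (1 + \<bar>r\<bar>) * e"
    using n(2) by (simp add: algebra_simps)
  moreover have "\<bar>generalised_limit ?h - r * generalised_limit f\<bar> = (2 + \<bar>r\<bar>) * e"
    by (simp add: e_def)
  ultimately show False using \<open>e > 0\<close> by (simp add: algebra_simps)
qed

lemma generalised_limit_abs_le:
  assumes "\<And>n. \<bar>f n\<bar> \<le> c"
  shows "\<bar>generalised_limit f\<bar> \<le> c"
proof (rule field_le_epsilon)
  fix e :: real assume "e > 0"
  have "Bseq f" using assms by (intro BseqI'[of _ c]) auto
  obtain n where "\<forall>k\<in>{f}. \<bar>k n - generalised_limit k\<bar> < e"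
    by (rule generalised_limit_approx[of "{f}" e 0]) (use \<open>Bseq f\<close> \<open>e > 0\<close> in auto)
  then show "\<bar>generalised_limit f\<bar> \<le> c + e" using assms[of n] by simp
qed

text \<open>
  All sequences of functionals are limited along the same generalised limit. Choosing weak* cluster
  points separately for each sequence would not do: a bound on \<open>y n - z n\<close> for every \<open>n\<close> would say
  nothing about cluster points reached along different indices.
\<close>

definition weak_star_limit ::
    "(nat \<Rightarrow> 'a::real_normed_vector \<Rightarrow>\<^sub>L real) \<Rightarrow> 'a \<Rightarrow>\<^sub>L real" where
  "weak_star_limit y = Blinfun (\<lambda>x. generalised_limit (\<lambda>n. y n x))"

lemma Bseq_blinfun_apply:
  fixes y :: "nat \<Rightarrow> 'a::real_normed_vector \<Rightarrow>\<^sub>L real"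
  assumes "Bseq y" shows "Bseq (\<lambda>n. y n x)"
proof -
  obtain K where K: "\<forall>n. norm (y n) \<le> K" using assms by (auto simp: Bseq_def)
  have "norm (y n x) \<le> K * norm x" for n
    using norm_blinfun[of "y n" x] K by (meson mult_right_mono norm_ge_zero order_trans)
  then show ?thesis by (rule BseqI')
qed

lemma weak_star_limit_apply:
  fixes y :: "nat \<Rightarrow> 'a::real_normed_vector \<Rightarrow>\<^sub>L real"
  assumes "Bseq y"
  shows "weak_star_limit y x = generalised_limit (\<lambda>n. y n x)"
proof -
  obtain K where K: "\<forall>n. norm (y n) \<le> K" using assms by (auto simp: Bseq_def)
  note B = Bseq_blinfun_apply[OF assms]
  have "bounded_linear (\<lambda>x. generalised_limit (\<lambda>n. y n x))"
  proof (rule bounded_linear_intro[where K = K])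
    fix u v :: 'a and r :: real
    show "generalised_limit (\<lambda>n. y n (u + v))
        = generalised_limit (\<lambda>n. y n u) + generalised_limit (\<lambda>n. y n v)"
      using generalised_limit_add[OF B B] by (simp add: blinfun.add_right)
    show "generalised_limit (\<lambda>n. y n (r *\<^sub>R u)) = r *\<^sub>R generalised_limit (\<lambda>n. y n u)"
      using generalised_limit_mult[OF B] by (simp add: blinfun.scaleR_right)
    have "\<bar>y n u\<bar> \<le> norm u * K" for n
      using norm_blinfun[of "y n" u] K
      by (metis mult.commute mult_right_mono norm_ge_zero order_trans real_norm_def)
    then show "norm (generalised_limit (\<lambda>n. y n u)) \<le> norm u * K"
      using generalised_limit_abs_le by simp
  qed
  then show ?thesis by (simp add: weak_star_limit_def bounded_linear_Blinfun_apply)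
qed

text \<open>
  Lower semicontinuity of the dual norm. It makes the partial limits of a Lipschitz map on a Hamming
  cube Lipschitz with the same constant, and it also bounds the difference between the map and its
  partial limit.
\<close>

lemma norm_weak_star_limit_diff_le:
  fixes y z :: "nat \<Rightarrow> 'a::real_normed_vector \<Rightarrow>\<^sub>L real"
  assumes "Bseq y" "Bseq z" "\<And>n. norm (y n - z n) \<le> c"
  shows "norm (weak_star_limit y - weak_star_limit z) \<le> c"
proof (rule norm_blinfun_bound)
  show "c \<ge> 0" using assms(3)[of 0] norm_ge_zero order_trans by blast
  fix x :: 'a
  note B = Bseq_blinfun_apply[OF assms(1), of x] Bseq_blinfun_apply[OF assms(2), of x]
  have Bm: "Bseq (\<lambda>n. - 1 * z n x)" using B(2) by (rule Bseq_mult[OF Bfun_const])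
  have "(weak_star_limit y - weak_star_limit z) x = generalised_limit (\<lambda>n. (y n - z n) x)"
    using generalised_limit_add[OF B(1) Bm] generalised_limit_mult[OF B(2), of "- 1"]
    by (simp add: blinfun.diff_left weak_star_limit_apply assms)
  moreover have "\<bar>(y n - z n) x\<bar> \<le> c * norm x" for n
    using norm_blinfun[of "y n - z n" x] assms(3)[of n]
    by (metis mult_right_mono norm_ge_zero order_trans real_norm_def)
  ultimately show "norm ((weak_star_limit y - weak_star_limit z) x) \<le> c * norm x"
    using generalised_limit_abs_le[of "\<lambda>n. (y n - z n) x" "c * norm x"] by simp
qed

lemma weak_star_limit_const: "weak_star_limit (\<lambda>_. w) = w"
proof (rule blinfun_eqI)
  fix x
  have B: "Bseq (\<lambda>_::nat. w)" by (simp add: Bfun_const)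
  have "\<bar>generalised_limit (\<lambda>_. w x) - w x\<bar> \<le> e" if "e > 0" for e
    by (rule generalised_limit_approx[of "{\<lambda>_. w x}" e 0])
      (use that in \<open>auto simp: Bfun_const abs_minus_commute\<close>)
  then have "generalised_limit (\<lambda>_. w x) = w x"
    by (metis abs_le_zero_iff eq_iff_diff_eq_0 field_le_epsilon add_0)
  then show "weak_star_limit (\<lambda>_. w) x = w x" by (simp add: weak_star_limit_apply[OF B])
qed


section \<open>Coordinate projections and the Tsirelson norm\<close>

lift_definition proj :: "nat set \<Rightarrow> c00 \<Rightarrow> c00" is restrict_coords
  using fin_supp_intros(3) by (simp add: restrict_coords_def)

lift_definition unit_vec :: "nat \<Rightarrow> c00" is "\<lambda>i j. if j = i \<and> i \<noteq> 0 then 1 else 0"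
proof -
  fix i :: nat
  have "{j. (if j = i \<and> i \<noteq> 0 then 1 else 0) \<noteq> (0::real)} \<subseteq> {i}" by auto
  then show "fin_supp (\<lambda>j. if j = i \<and> i \<noteq> 0 then 1 else 0) \<and> (if (0::nat) = i \<and> i \<noteq> 0 then 1 else 0) = (0::real)"
    by (auto intro: finite_subset)
qed

lemma coord_proj: "coord (proj E x) j = (if j \<in> E then coord x j else 0)"
  by transfer (simp add: restrict_coords_def)

lemma coord_add: "coord (x + y) j = coord x j + coord y j"
  by transfer simp

lemma coord_scaleR: "coord (r *\<^sub>R x) j = r * coord x j"
  by transfer simp

lemma coord_zero: "coord 0 j = 0"
  by transfer simp

lemma coord_at_0: "coord x 0 = 0"
  by transfer simp

lemma coord_sum: "coord (\<Sum>i\<in>I. x i) j = (\<Sum>i\<in>I. coord (x i) j)"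
  by (induction I rule: infinite_finite_induct) (simp_all add: coord_zero coord_add)

lemma c00_eqI: "(\<And>j. coord x j = coord y j) \<Longrightarrow> x = y"
  by transfer auto

lemma finite_coord_support: "finite {j. coord x j \<noteq> 0}"
  by transfer simp

lemma abs_coord_le_norm: "\<bar>coord x j\<bar> \<le> norm x"
  by transfer (simp add: abs_le_tsirelson_norm)

lemma proj_add: "proj E (x + y) = proj E x + proj E y"
  by (rule c00_eqI) (simp add: coord_proj coord_add)

lemma proj_scaleR: "proj E (r *\<^sub>R x) = r *\<^sub>R proj E x"
  by (rule c00_eqI) (simp add: coord_proj coord_scaleR)

lemma proj_sum: "proj E (\<Sum>i\<in>I. x i) = (\<Sum>i\<in>I. proj E (x i))"
  by (rule c00_eqI) (simp add: coord_proj coord_sum)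

lemma proj_proj: "proj E (proj F x) = proj (E \<inter> F) x"
  by (rule c00_eqI) (simp add: coord_proj)

lemma proj_eq_self: "(\<And>j. coord x j \<noteq> 0 \<Longrightarrow> j \<in> E) \<Longrightarrow> proj E x = x"
  by (rule c00_eqI) (auto simp: coord_proj)

lemma proj_eq_0: "(\<And>j. j \<in> E \<Longrightarrow> coord x j = 0) \<Longrightarrow> proj E x = 0"
  by (rule c00_eqI) (simp add: coord_proj coord_zero)

lemma proj_eq_sum_unit_vec: "finite E \<Longrightarrow> proj E x = (\<Sum>j\<in>E. coord x j *\<^sub>R unit_vec j)"
proof (rule c00_eqI)
  fix i assume "finite E"
  have "coord (unit_vec j) i = (if i = j \<and> j \<noteq> 0 then 1 else 0)" for j by transfer simp
  then have "coord x j * coord (unit_vec j) i = (if j = i then coord x i else 0)" for j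
    by (auto simp: coord_at_0)
  then show "coord (proj E x) i = coord (\<Sum>j\<in>E. coord x j *\<^sub>R unit_vec j) i"
    using \<open>finite E\<close> by (simp add: coord_proj coord_sum coord_scaleR sum.delta)
qed


lemma tsirelson_norm_approx_restrict_le:
  assumes "fin_supp x"
  shows "tsirelson_norm_approx k (restrict_coords E x) \<le> tsirelson_norm_approx k x"
  using assms
proof (induction k arbitrary: x)
  case 0
  have "\<bar>restrict_coords E x j\<bar> \<le> tsirelson_norm_approx 0 x" for j
    using abs_le_tsirelson_norm_approx[OF 0, of j 0] by (auto simp: restrict_coords_def)
  then show ?case
    using fin_supp_finite_range[OF fin_supp_intros(3)[OF 0]]
    by (subst tsirelson_norm_approx.simps(1)) (subst Max_le_iff; auto)
next
  case (Suc k)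
  show ?case
  proof (rule tsirelson_norm_approx_SucI)
    show "fin_supp (restrict_coords E x)" by (intro fin_supp_intros Suc.prems)
    show "tsirelson_norm_approx k (restrict_coords E x) \<le> tsirelson_norm_approx (Suc k) x"
      using Suc.IH[OF Suc.prems] tsirelson_norm_approx_mono[of k x] by linarith
    fix Es assume Es: "admissible Es"
    have "(\<Sum>F\<leftarrow>Es. tsirelson_norm_approx k (restrict_coords F (restrict_coords E x)))
        \<le> (\<Sum>F\<leftarrow>Es. tsirelson_norm_approx k (restrict_coords F x))"
    proof (rule sum_list_mono)
      fix F
      have "restrict_coords F (restrict_coords E x) = restrict_coords E (restrict_coords F x)"
        by (auto simp: restrict_coords_def)
      then show "tsirelson_norm_approx k (restrict_coords F (restrict_coords E x))
          \<le> tsirelson_norm_approx k (restrict_coords F x)"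
        using Suc.IH[OF fin_supp_intros(3)[OF Suc.prems]] by simp
    qed
    then show "1 / 2 * (\<Sum>F\<leftarrow>Es. tsirelson_norm_approx k (restrict_coords F (restrict_coords E x)))
        \<le> tsirelson_norm_approx (Suc k) x"
      using tsirelson_norm_approx_admissible[OF Suc.prems Es, of k] by linarith
  qed
qed

lemma norm_proj_le: "norm (proj E x) \<le> norm x"
  by transfer (auto intro!: LIMSEQ_le[OF tsirelson_norm_LIMSEQ tsirelson_norm_LIMSEQ]
      tsirelson_norm_approx_restrict_le fin_supp_intros)

lemma tsirelson_norm_approx_le_norm:
  fixes x :: c00
  shows "tsirelson_norm_approx k (coord x) \<le> norm x"
proof transfer
  fix k x assume "fin_supp x \<and> x 0 = 0"
  then show "tsirelson_norm_approx k x \<le> tsirelson_norm x"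
    using incseq_le[OF _ tsirelson_norm_LIMSEQ] incseq_SucI[of "\<lambda>k. tsirelson_norm_approx k x"]
      tsirelson_norm_approx_mono by blast
qed

lemma tendsto_sum_list:
  fixes f :: "'b \<Rightarrow> nat \<Rightarrow> real"
  assumes "\<And>E. E \<in> set Es \<Longrightarrow> f E \<longlonglongrightarrow> l E"
  shows "(\<lambda>k. \<Sum>E\<leftarrow>Es. f E k) \<longlonglongrightarrow> (\<Sum>E\<leftarrow>Es. l E)"
  using assms by (induction Es) (auto intro: tendsto_add)

lemma coord_proj_fun: "coord (proj E x) = restrict_coords E (coord x)"
  by transfer simp

lemma norm_LIMSEQ: "(\<lambda>k. tsirelson_norm_approx k (coord x)) \<longlonglongrightarrow> norm x"
  by transfer (simp add: tsirelson_norm_LIMSEQ)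

text \<open>
  The next two lemmas are the two halves of the implicit equation
  \<open>norm x = max (max_j \<bar>x_j\<bar>) (1/2 * max (\<Sum> norm (E_j x)))\<close> of Tsirelson's norm.
\<close>

lemma admissible_sum_le_norm:
  assumes "admissible Es"
  shows "(\<Sum>E\<leftarrow>Es. norm (proj E x)) \<le> 2 * norm x"
proof -
  have "(\<lambda>k. \<Sum>E\<leftarrow>Es. tsirelson_norm_approx k (coord (proj E x))) \<longlonglongrightarrow> (\<Sum>E\<leftarrow>Es. norm (proj E x))"
    by (intro tendsto_sum_list norm_LIMSEQ)
  moreover have "(\<Sum>E\<leftarrow>Es. tsirelson_norm_approx k (coord (proj E x))) \<le> 2 * norm x" for k
    using tsirelson_norm_approx_admissible[OF finite_coord_support[of x] assms, of k]
      tsirelson_norm_approx_le_norm[where k = "Suc k" and x = x]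
    unfolding coord_proj_fun by linarith
  ultimately show ?thesis by (intro LIMSEQ_le_const2) auto
qed

lemma norm_le_admissibleI:
  assumes "\<And>j. \<bar>coord x j\<bar> \<le> c"
    and "\<And>Es. admissible Es \<Longrightarrow> (\<Sum>E\<leftarrow>Es. norm (proj E x)) \<le> 2 * c"
  shows "norm x \<le> c"
proof -
  have "tsirelson_norm_approx k (coord x) \<le> c" for k
  proof (induction k)
    case 0
    show ?case
      using fin_supp_finite_range[OF finite_coord_support[of x]] assms(1)
      by (subst tsirelson_norm_approx.simps(1)) (subst Max_le_iff; auto)
  next
    case (Suc k)
    show ?case
    proof (rule tsirelson_norm_approx_SucI[OF finite_coord_support Suc])
      fix Es assume "admissible Es"
      have "(\<Sum>E\<leftarrow>Es. tsirelson_norm_approx k (restrict_coords E (coord x)))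
          \<le> (\<Sum>E\<leftarrow>Es. norm (proj E x))"
        unfolding coord_proj_fun[symmetric]
        by (intro sum_list_mono tsirelson_norm_approx_le_norm)
      then show "1 / 2 * (\<Sum>E\<leftarrow>Es. tsirelson_norm_approx k (restrict_coords E (coord x))) \<le> c"
        using assms(2)[OF \<open>admissible Es\<close>] by linarith
    qed
  qed
  then show ?thesis by (intro LIMSEQ_le_const2[OF norm_LIMSEQ]) auto
qed


section \<open>Tails of functionals on Tsirelson's space\<close>

lemma sorted_blocks_cases:
  assumes "sorted_wrt (\<lambda>E F :: nat set. Max E < Min F) Es" "E \<in> set Es" "F \<in> set Es" "E \<noteq> F"
  shows "Max E < Min F \<or> Max F < Min E"
  using assms by (induction Es) auto

lemma admissible_distinct:
  assumes "admissible Es" shows "distinct Es"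
proof -
  have "distinct Fs" if "sorted_wrt (\<lambda>E F :: nat set. Max E < Min F) Fs"
    "\<forall>E\<in>set Fs. finite E \<and> E \<noteq> {}" for Fs
    using that
  proof (induction Fs)
    case (Cons E Fs)
    have "E \<notin> set Fs"
      using admissible_disjoint[of E Fs E] Cons.prems by auto
    then show ?case using Cons by simp
  qed simp
  then show ?thesis using assms by (simp add: admissible_def)
qed

lemma admissible_Min_hd_le:
  assumes "admissible Es" "E \<in> set Es" "j \<in> E"
  shows "Min (hd Es) \<le> j"
proof -
  obtain E0 Fs where Es: "Es = E0 # Fs" using assms(1) by (cases Es) (auto simp: admissible_def)
  have fin: "finite E0" "E0 \<noteq> {}" "finite E" "E \<noteq> {}"
    using assms(1,2) Es unfolding admissible_def by auto
  have "Min E0 \<le> Min E"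
  proof (cases "E = E0")
    case False
    then have "E \<in> set Fs" using assms(2) Es by simp
    moreover have "sorted_wrt (\<lambda>E F. Max E < Min F) (E0 # Fs)"
      using assms(1) Es unfolding admissible_def by blast
    ultimately have "Max E0 < Min E" by simp
    moreover have "Min E0 \<le> Max E0" using fin by simp
    ultimately show ?thesis by simp
  qed simp
  also have "Min E \<le> j" using fin assms(3) by simp
  finally show ?thesis by (simp add: Es)
qed

text \<open>
  If two of the sets meet the interval \<open>{a<..b}\<close>, then the earlier one ends inside it. So all sets
  that meet the interval, except possibly the last, are counted by the cardinality on the right.
  Every set ends in at most one of a family of disjoint intervals, so these cardinalities add up
  to at most the number of sets when \<open>u\<close> runs through a block sequence.
\<close>

lemma sum_norm_proj_block_le:
  assumes sorted: "sorted_wrt (\<lambda>E F :: nat set. Max E < Min F) Es"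
    and fin: "\<forall>E\<in>set Es. finite E \<and> E \<noteq> {}"
    and supp: "\<And>j. coord u j \<noteq> 0 \<Longrightarrow> a < j \<and> j \<le> b"
    and u: "norm u \<le> 1"
  shows "(\<Sum>E\<in>set Es. norm (proj E u)) \<le> 1 + real (card {E \<in> set Es. Max E \<in> {a<..b}})"
proof -
  let ?A = "{E \<in> set Es. Max E \<in> {a<..b}}"
  let ?B = "{E \<in> set Es. Max E \<notin> {a<..b}}"
  let ?C = "{E \<in> set Es. Max E \<notin> {a<..b} \<and> E \<inter> {a<..b} \<noteq> {}}"
  have le1: "norm (proj E u) \<le> 1" for E using norm_proj_le[of E u] u by linarith
  have notboth: "\<not> Max E < Min F" if EF: "E \<in> ?C" "F \<in> ?C" for E F
  proof
    assume less: "Max E < Min F"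
    obtain i j where "i \<in> E \<inter> {a<..b}" "j \<in> F \<inter> {a<..b}" using EF by blast
    then have ij: "i \<in> E" "a < i" "j \<in> F" "j \<le> b" by auto
    have "i \<le> Max E" "Min F \<le> j" using EF fin ij by auto
    then have "Max E \<in> {a<..b}" using less ij by auto
    then show False using EF by simp
  qed
  have "card ?C \<le> 1"
  proof -
    have "E = F" if EF: "E \<in> ?C" "F \<in> ?C" for E F
    proof (rule ccontr)
      assume "E \<noteq> F"
      then have "Max E < Min F \<or> Max F < Min E"
        using EF by (intro sorted_blocks_cases[OF sorted]) simp_all
      then show False using notboth[OF EF] notboth[OF EF(2,1)] by simp
    qed
    then have "\<forall>E\<in>?C. \<forall>F\<in>?C. E = F" by blast
    moreover have "finite ?C" by simp
    ultimately show ?thesis using card_le_Suc0_iff_eq[of ?C] by (simp only: One_nat_def)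
  qed
  have "(\<Sum>E\<in>?A. norm (proj E u)) \<le> card ?A"
    using sum_bounded_above[of ?A "\<lambda>E. norm (proj E u)" 1] le1 by simp
  moreover have "(\<Sum>E\<in>?B. norm (proj E u)) = (\<Sum>E\<in>?C. norm (proj E u))"
  proof (rule sum.mono_neutral_right)
    show "\<forall>E\<in>?B - ?C. norm (proj E u) = 0"
    proof
      fix E assume "E \<in> ?B - ?C"
      then have "E \<inter> {a<..b} = {}" by blast
      then have "proj E u = 0" using supp by (intro proj_eq_0) (meson disjoint_iff greaterThanAtMost_iff)
      then show "norm (proj E u) = 0" by simp
    qed
  qed auto
  moreover have "(\<Sum>E\<in>?C. norm (proj E u)) \<le> card ?C"
    using sum_bounded_above[of ?C "\<lambda>E. norm (proj E u)" 1] le1 by simp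
  moreover have "(\<Sum>E\<in>set Es. norm (proj E u)) = (\<Sum>E\<in>?A. norm (proj E u)) + (\<Sum>E\<in>?B. norm (proj E u))"
    by (subst sum.union_disjoint[symmetric]) (auto intro!: sum.cong)
  ultimately show ?thesis using \<open>card ?C \<le> 1\<close> by linarith
qed

text \<open>
  A family of admissible sets that starts before the end of \<open>u 0\<close> has at most \<open>p 1\<close> members. On a long
  average of later blocks so few sets lose the factor \<open>1/2\<close> almost completely, because most blocks
  are met by one set only; the average then contributes about \<open>1/2\<close> to the norm. A family that starts
  later does not see \<open>u 0\<close>. Hence the norm is close to \<open>3/2\<close> rather than \<open>2\<close>, which excludes
  isometric behaviour like that of \<open>\<ell>\<^sub>1\<close> on block sequences.
\<close>

lemma norm_head_plus_average_le:
  fixes u :: "nat \<Rightarrow> c00" and p :: "nat \<Rightarrow> nat"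
  assumes "mono p"
    and supp: "\<And>i j. coord (u i) j \<noteq> 0 \<Longrightarrow> p i < j \<and> j \<le> p (Suc i)"
    and u: "\<And>i. norm (u i) \<le> 1"
    and r: "r \<ge> 1"
  shows "norm (u 0 + (1 / real r) *\<^sub>R (\<Sum>i=1..r. u i)) \<le> 3 / 2 + p 1 / (2 * real r)"
proof -
  define z where "z = (1 / real r) *\<^sub>R (\<Sum>i=1..r. u i)"
  define c where "c = 3 / 2 + p 1 / (2 * real r)"
  have "norm (\<Sum>i=1..r. u i) \<le> r"
    using sum_norm_bound[of "{1..r}" u 1] u by simp
  then have z: "norm z \<le> 1" using r by (simp add: z_def)
  have z_supp: "coord z j = 0" if "j \<le> p 1" for j
  proof -
    have "coord (u i) j = 0" if "i \<in> {1..r}" for i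
      using supp[of i j] monoD[OF \<open>mono p\<close>, of 1 i] that \<open>j \<le> p 1\<close> by fastforce
    then show ?thesis by (simp add: z_def coord_scaleR coord_sum)
  qed
  have c: "c \<ge> 1" unfolding c_def by (rule order_trans[of _ "3 / 2"]) simp_all
  have "norm (u 0 + z) \<le> c"
  proof (rule norm_le_admissibleI)
    fix j
    have "coord (u 0) j = 0" if "j > p 1" using supp[of 0 j] that by auto
    then show "\<bar>coord (u 0 + z) j\<bar> \<le> c"
      using abs_coord_le_norm[of "u 0" j] abs_coord_le_norm[of z j] u[of 0] z z_supp[of j] c
      by (cases "j \<le> p 1") (auto simp: coord_add)
  next
    fix Es assume Es: "admissible Es"
    show "(\<Sum>E\<leftarrow>Es. norm (proj E (u 0 + z))) \<le> 2 * c"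
    proof (cases "p 1 < Min (hd Es)")
      case True
      have "proj E (u 0) = 0" if "E \<in> set Es" for E
      proof (rule proj_eq_0)
        fix j assume "j \<in> E"
        then have "p 1 < j" using admissible_Min_hd_le[OF Es that, of j] True by simp
        then show "coord (u 0) j = 0" using supp[of 0 j] by auto
      qed
      then have "(\<Sum>E\<leftarrow>Es. norm (proj E (u 0 + z))) = (\<Sum>E\<leftarrow>Es. norm (proj E z))"
        by (intro arg_cong[where f = sum_list] map_cong) (simp_all add: proj_add)
      then show ?thesis using admissible_sum_le_norm[OF Es, of z] z c by linarith
    next
      case False
      have card: "card (set Es) \<le> p 1"
        using False Es distinct_card[OF admissible_distinct[OF Es]] unfolding admissible_def
        by linarith
      have to_set: "(\<Sum>E\<leftarrow>Es. f E) = (\<Sum>E\<in>set Es. f E)" for f :: "nat set \<Rightarrow> real"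
        by (simp add: sum.distinct_set_conv_list[OF admissible_distinct[OF Es]])
      define A where "A i = {E \<in> set Es. Max E \<in> {p i<..p (Suc i)}}" for i
      have disj: "A i \<inter> A j = {}" if "i < j" for i j
        using monoD[OF \<open>mono p\<close>, of "Suc i" j] that by (fastforce simp: A_def)
      have "(\<Sum>i=1..r. card (A i)) = card (\<Union>i\<in>{1..r}. A i)"
      proof (rule card_UN_disjoint[symmetric])
        show "\<forall>i\<in>{1..r}. \<forall>j\<in>{1..r}. i \<noteq> j \<longrightarrow> A i \<inter> A j = {}"
          using disj by (metis Int_commute linorder_neqE_nat)
      qed (auto simp: A_def)
      also have "\<dots> \<le> card (set Es)" by (rule card_mono) (auto simp: A_def)
      finally have count: "(\<Sum>i=1..r. card (A i)) \<le> p 1" using card by simp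
      have "(\<Sum>E\<in>set Es. norm (proj E z))
          \<le> (\<Sum>E\<in>set Es. (1 / real r) * (\<Sum>i=1..r. norm (proj E (u i))))"
        by (intro sum_mono) (simp add: z_def proj_scaleR proj_sum norm_sum divide_right_mono)
      also have "\<dots> = (1 / real r) * (\<Sum>i=1..r. \<Sum>E\<in>set Es. norm (proj E (u i)))"
        unfolding sum_distrib_left[symmetric] by (subst sum.swap) (rule refl)
      also have "\<dots> \<le> (1 / real r) * (\<Sum>i=1..r. 1 + real (card (A i)))"
      proof (intro mult_left_mono sum_mono)
        fix i
        show "(\<Sum>E\<in>set Es. norm (proj E (u i))) \<le> 1 + real (card (A i))"
          unfolding A_def
        proof (rule sum_norm_proj_block_le[OF _ _ supp u])
          show "sorted_wrt (\<lambda>E F. Max E < Min F) Es" "\<forall>E\<in>set Es. finite E \<and> E \<noteq> {}"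
            using Es unfolding admissible_def by blast+
        qed
      qed simp
      also have "\<dots> = (1 / real r) * (r + real (\<Sum>i=1..r. card (A i)))"
        by (simp add: sum.distrib)
      also have "\<dots> \<le> (1 / real r) * (r + real (p 1))"
        using count by (intro mult_left_mono add_left_mono of_nat_mono) simp_all
      also have "\<dots> = 1 + p 1 / real r" using r by (simp add: field_simps)
      finally have "(\<Sum>E\<leftarrow>Es. norm (proj E z)) \<le> 1 + p 1 / real r" by (simp add: to_set)
      moreover have "(\<Sum>E\<leftarrow>Es. norm (proj E (u 0))) \<le> 2"
        using admissible_sum_le_norm[OF Es, of "u 0"] u[of 0] by linarith
      moreover have "(\<Sum>E\<leftarrow>Es. norm (proj E (u 0 + z)))
          \<le> (\<Sum>E\<leftarrow>Es. norm (proj E (u 0))) + (\<Sum>E\<leftarrow>Es. norm (proj E z))"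
        unfolding sum_list_addf[symmetric] proj_add by (intro sum_list_mono norm_triangle_ineq)
      ultimately show ?thesis by (simp add: c_def)
    qed
  qed
  then show ?thesis by (simp add: z_def c_def)
qed

lemma linear_on_c00:
  fixes w :: tsirelson_dual
  shows "linear (\<lambda>x. w (to_completion x))"
  using linear_compose[OF linear_to_completion bounded_linear.linear[OF blinfun.bounded_linear_right[of w]]]
  by (simp add: comp_def)

text \<open>
  The unit vector basis is shrinking: the norms of the tails of a functional tend to \<open>0\<close>. If they
  are eventually at most \<open>c\<close> but never at most \<open>7/8 * c\<close>, then there are normalised blocks on
  which the functional exceeds \<open>7/8 * c\<close>, so it exceeds \<open>7/4 * c\<close> at a block plus a long average of later
  blocks. That vector has norm at most \<open>13/8\<close>, which gives a value of at most \<open>13/8 * c\<close>. So each bound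
  \<open>c\<close> improves to \<open>7/8 * c\<close>, arbitrarily often.
\<close>

lemma functional_tail_small:
  fixes w :: tsirelson_dual
  assumes "e > 0"
  shows "\<exists>N. \<forall>x. \<bar>w (to_completion (proj {N<..} x))\<bar> \<le> e * norm x"
proof -
  define \<phi> where "\<phi> x = w (to_completion x)" for x
  have lin: "linear \<phi>" unfolding \<phi>_def by (rule linear_on_c00)
  define Q where "Q c \<longleftrightarrow> (\<exists>N. \<forall>x. \<bar>\<phi> (proj {N<..} x)\<bar> \<le> c * norm x)" for c
  have step: "Q (7 / 8 * c)" if "c > 0" "Q c" for c
  proof (rule ccontr)
    assume "\<not> Q (7 / 8 * c)"
    then have bad: "\<exists>x. \<bar>\<phi> (proj {N<..} x)\<bar> > 7 / 8 * c * norm x" for N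
      unfolding Q_def by (meson not_le)
    have "\<exists>v M. N \<le> M \<and> (\<forall>j. coord v j \<noteq> 0 \<longrightarrow> N < j \<and> j \<le> M) \<and> norm v \<le> 1 \<and> \<phi> v > 7 / 8 * c"
      for N
    proof -
      obtain x where x: "\<bar>\<phi> (proj {N<..} x)\<bar> > 7 / 8 * c * norm x" using bad by blast
      define y where "y = proj {N<..} x"
      have "norm x > 0"
      proof (rule ccontr)
        assume "\<not> norm x > 0"
        then have "y = 0" using norm_proj_le[of "{N<..}" x] by (simp add: y_def)
        then show False using x \<open>\<not> norm x > 0\<close> linear_0[OF lin] by (simp add: y_def)
      qed
      define v where "v = (sgn (\<phi> y) / norm x) *\<^sub>R y"
      have "\<phi> v = \<bar>\<phi> y\<bar> / norm x"
        by (simp add: v_def linear_cmul[OF lin] abs_sgn mult.commute)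
      then have "\<phi> v > 7 / 8 * c"
        using x \<open>norm x > 0\<close> by (simp add: y_def pos_less_divide_eq)
      moreover have "norm v \<le> 1"
      proof -
        have "norm v \<le> 1 / norm x * norm y"
          unfolding v_def norm_scaleR by (intro mult_right_mono) (auto simp: abs_div sgn_real_def)
        also have "\<dots> \<le> 1"
          using norm_proj_le[of "{N<..}" x] \<open>norm x > 0\<close> by (simp add: y_def)
        finally show ?thesis .
      qed
      moreover define M where "M = Max (insert N {j. coord v j \<noteq> 0})"
      have "N \<le> M" using finite_coord_support[of v] by (simp add: M_def)
      moreover have "N < j \<and> j \<le> M" if "coord v j \<noteq> 0" for j
      proof
        show "N < j" using that by (auto simp: v_def y_def coord_scaleR coord_proj split: if_splits)
        show "j \<le> M" using that finite_coord_support[of v] by (simp add: M_def)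
      qed
      ultimately show ?thesis by blast
    qed
    then obtain U M where UM: "\<And>N. N \<le> M N"
      "\<And>N j. coord (U N) j \<noteq> 0 \<Longrightarrow> N < j \<and> j \<le> M N" "\<And>N. norm (U N) \<le> 1"
      "\<And>N. \<phi> (U N) > 7 / 8 * c"
      by metis
    obtain N0 where N0: "\<And>x. \<bar>\<phi> (proj {N0<..} x)\<bar> \<le> c * norm x"
      using \<open>Q c\<close> unfolding Q_def by blast
    define p where "p i = (M ^^ i) N0" for i
    have p_Suc: "p (Suc i) = M (p i)" for i by (simp add: p_def)
    have "mono p" by (rule incseq_SucI) (simp add: p_Suc UM)
    define u where "u i = U (p i)" for i
    \<comment> \<open>So long an average makes the error term in the estimate of the norm at most 1/8.\<close>
    define r where "r = 4 * p 1 + 1"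
    define v where "v = u 0 + (1 / real r) *\<^sub>R (\<Sum>i=1..r. u i)"
    have supp: "p i < j \<and> j \<le> p (Suc i)" if "coord (u i) j \<noteq> 0" for i j
      using UM(2) that by (simp add: u_def p_Suc)
    have "norm v \<le> 3 / 2 + p 1 / (2 * real r)"
      unfolding v_def by (rule norm_head_plus_average_le[OF \<open>mono p\<close> supp])
        (auto simp: u_def UM r_def)
    also have "\<dots> \<le> 13 / 8"
      by (simp add: r_def field_simps)
    finally have v: "norm v \<le> 13 / 8" .
    have "(\<Sum>i=1..r. \<phi> (u i)) \<ge> (\<Sum>i=1..r. 7 / 8 * c)"
      by (intro sum_mono) (simp only: u_def less_imp_le[OF UM(4)])
    then have "(1 / real r) * (\<Sum>i=1..r. \<phi> (u i)) \<ge> 7 / 8 * c"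
      by (simp add: r_def field_simps)
    moreover have "\<phi> v = \<phi> (u 0) + (1 / real r) * (\<Sum>i=1..r. \<phi> (u i))"
      by (simp add: v_def linear_add[OF lin] linear_cmul[OF lin] linear_sum[OF lin])
    moreover have "\<phi> (u 0) > 7 / 8 * c" by (simp only: u_def UM(4))
    ultimately have "\<phi> v > 7 / 4 * c" by linarith
    moreover have "proj {N0<..} v = v"
    proof (rule proj_eq_self)
      fix j assume "coord v j \<noteq> 0"
      then obtain i where "coord (u i) j \<noteq> 0"
        unfolding v_def coord_add coord_scaleR coord_sum
        by (metis add_0 mult_zero_right sum.neutral)
      then have "p i < j" using supp by blast
      moreover have "p 0 \<le> p i" using \<open>mono p\<close> by (simp add: monoD)
      ultimately show "j \<in> {N0<..}" by (simp add: p_def)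
    qed
    ultimately have "7 / 4 * c < c * norm v" using N0[of v] by simp
    also have "\<dots> \<le> c * (13 / 8)" using v \<open>c > 0\<close> by (intro mult_left_mono) auto
    finally show False using \<open>c > 0\<close> by simp
  qed
  define c where "c = norm w + 1"
  have "c > 0" using norm_ge_zero[of w] unfolding c_def by linarith
  have "Q ((7 / 8) ^ n * c)" for n
  proof (induction n)
    case 0
    have "\<bar>\<phi> (proj {0<..} x)\<bar> \<le> c * norm x" for x
    proof -
      have "\<bar>\<phi> (proj {0<..} x)\<bar> \<le> norm w * norm (proj {0<..} x)"
        using norm_blinfun[of w "to_completion (proj {0<..} x)"] by (simp add: \<phi>_def)
      also have "\<dots> \<le> c * norm x" by (intro mult_mono norm_proj_le) (auto simp: c_def)
      finally show ?thesis .
    qed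
    then show ?case unfolding Q_def by auto
  next
    case (Suc n)
    show ?case using step[OF _ Suc] \<open>c > 0\<close> by (simp add: mult.assoc)
  qed
  moreover obtain n where "(7 / 8) ^ n < e / c"
    using real_arch_pow_inv[of "e / c" "7 / 8"] \<open>e > 0\<close> \<open>c > 0\<close> by auto
  ultimately obtain N where N: "\<And>x. \<bar>\<phi> (proj {N<..} x)\<bar> \<le> (7 / 8) ^ n * c * norm x"
    unfolding Q_def by blast
  have "\<bar>\<phi> (proj {N<..} x)\<bar> \<le> e * norm x" for x
  proof -
    have "(7 / 8) ^ n * c \<le> e" using \<open>(7 / 8) ^ n < e / c\<close> \<open>c > 0\<close> by (simp add: field_simps)
    then show ?thesis using N[of x] by (meson mult_right_mono norm_ge_zero order_trans)
  qed
  then show ?thesis by (auto simp: \<phi>_def)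
qed


section \<open>Concentration of Lipschitz maps into the dual of Tsirelson's space\<close>

text \<open>
  This describes a sum of \<open>n\<close> functionals of norm at most \<open>L\<close> that are, up to an error \<open>e\<close> each, supported
  on successive finite sets between \<open>N\<close> and \<open>M\<close>. Only the resulting estimate is recorded, since it
  is preserved by sums of successive functionals and by negation.
\<close>

definition block_dominated :: "real \<Rightarrow> real \<Rightarrow> nat \<Rightarrow> nat \<Rightarrow> tsirelson_dual \<Rightarrow> nat \<Rightarrow> bool" where
  "block_dominated L e N M w n \<longleftrightarrow> N \<le> M \<and>
     (\<exists>Es. length Es = n \<and> sorted_wrt (\<lambda>E F. Max E < Min F) Es
        \<and> (\<forall>E\<in>set Es. finite E \<and> E \<noteq> {} \<and> E \<subseteq> {N<..M})
        \<and> (\<forall>x. \<bar>w (to_completion x)\<bar> \<le> L * (\<Sum>E\<leftarrow>Es. norm (proj E x)) + real n * e * norm x))"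

lemma block_dominated_zero: "block_dominated L e N N 0 0"
  unfolding block_dominated_def by (intro conjI exI[of _ "[]"]) auto

lemma block_dominated_uminus:
  "block_dominated L e N M w n \<Longrightarrow> block_dominated L e N M (- w) n"
  unfolding block_dominated_def by (simp add: blinfun.minus_left)

lemma block_dominated_add:
  assumes "block_dominated L e N M w n" "block_dominated L e M K v m"
  shows "block_dominated L e N K (w + v) (n + m)"
proof -
  obtain Es where Es: "length Es = n" "sorted_wrt (\<lambda>E F. Max E < Min F) Es"
    "\<And>E. E \<in> set Es \<Longrightarrow> finite E \<and> E \<noteq> {} \<and> E \<subseteq> {N<..M}"
    "\<And>x. \<bar>w (to_completion x)\<bar> \<le> L * (\<Sum>E\<leftarrow>Es. norm (proj E x)) + real n * e * norm x"
    using assms(1) unfolding block_dominated_def by blast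
  obtain Fs where Fs: "length Fs = m" "sorted_wrt (\<lambda>E F. Max E < Min F) Fs"
    "\<And>E. E \<in> set Fs \<Longrightarrow> finite E \<and> E \<noteq> {} \<and> E \<subseteq> {M<..K}"
    "\<And>x. \<bar>v (to_completion x)\<bar> \<le> L * (\<Sum>E\<leftarrow>Fs. norm (proj E x)) + real m * e * norm x"
    using assms(2) unfolding block_dominated_def by blast
  have NMK: "N \<le> M" "M \<le> K" using assms by (auto simp: block_dominated_def)
  have "Max E < Min F" if "E \<in> set Es" "F \<in> set Fs" for E F
  proof -
    have "Max E \<in> {N<..M}" "Min F \<in> {M<..K}"
      using Es(3)[OF that(1)] Fs(3)[OF that(2)] Max_in Min_in by blast+
    then show ?thesis by simp
  qed
  then have "sorted_wrt (\<lambda>E F. Max E < Min F) (Es @ Fs)"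
    using Es(2) Fs(2) by (simp add: sorted_wrt_append)
  moreover have "\<forall>E\<in>set (Es @ Fs). finite E \<and> E \<noteq> {} \<and> E \<subseteq> {N<..K}"
    using Es(3) Fs(3) NMK by fastforce
  moreover have "\<bar>(w + v) (to_completion x)\<bar>
      \<le> L * (\<Sum>E\<leftarrow>Es @ Fs. norm (proj E x)) + real (n + m) * e * norm x" for x
    using Es(4)[of x] Fs(4)[of x] by (simp add: blinfun.add_left algebra_simps)
  moreover have "length (Es @ Fs) = n + m" using Es(1) Fs(1) by simp
  ultimately show ?thesis using NMK unfolding block_dominated_def by (meson order_trans)
qed

text \<open>
  A functional that nearly vanishes on the first \<open>N\<close> coordinates is nearly supported on a finite
  interval beyond \<open>N\<close>, because its tail is small as well.
\<close>

lemma block_dominated_single: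
  fixes w :: tsirelson_dual
  assumes "e > 0" "norm w \<le> L" "(\<Sum>j\<le>N. \<bar>w (to_completion (unit_vec j))\<bar>) \<le> e / 2"
  shows "\<exists>M. block_dominated L e N M w 1"
proof -
  obtain M0 where M0: "\<And>x. \<bar>w (to_completion (proj {M0<..} x))\<bar> \<le> e / 2 * norm x"
    using functional_tail_small[of "e / 2" w] \<open>e > 0\<close> by auto
  \<comment> \<open>The successor keeps the supporting set \<open>{N<..M}\<close> nonempty.\<close>
  define M where "M = Suc (max N M0)"
  note lin = linear_on_c00[of w]
  have "\<bar>w (to_completion x)\<bar> \<le> L * norm (proj {N<..M} x) + e * norm x" for x
  proof -
    have head: "\<bar>w (to_completion (proj {..N} x))\<bar> \<le> e / 2 * norm x"
    proof -
      have "\<bar>w (to_completion (proj {..N} x))\<bar>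
          = \<bar>\<Sum>j\<le>N. coord x j * w (to_completion (unit_vec j))\<bar>"
        by (simp add: proj_eq_sum_unit_vec linear_sum[OF lin] linear_cmul[OF lin])
      also have "\<dots> \<le> (\<Sum>j\<le>N. \<bar>coord x j\<bar> * \<bar>w (to_completion (unit_vec j))\<bar>)"
        by (rule order_trans[OF sum_abs]) (simp add: abs_mult)
      also have "\<dots> \<le> (\<Sum>j\<le>N. norm x * \<bar>w (to_completion (unit_vec j))\<bar>)"
        by (intro sum_mono mult_right_mono abs_coord_le_norm) simp
      also have "\<dots> \<le> norm x * (e / 2)"
        unfolding sum_distrib_left[symmetric] using assms(3) by (rule mult_left_mono) simp
      finally show ?thesis by (simp add: mult.commute)
    qed
    have mid: "\<bar>w (to_completion (proj {N<..M} x))\<bar> \<le> L * norm (proj {N<..M} x)"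
      using norm_blinfun[of w "to_completion (proj {N<..M} x)"] assms(2)
      by simp (meson mult_right_mono norm_ge_zero order_trans)
    have tail: "\<bar>w (to_completion (proj {M<..} x))\<bar> \<le> e / 2 * norm x"
    proof -
      have "proj {M0<..} (proj {M<..} x) = proj {M<..} x"
        by (simp add: proj_proj M_def Int_absorb1)
      then have "\<bar>w (to_completion (proj {M<..} x))\<bar> \<le> e / 2 * norm (proj {M<..} x)"
        using M0[of "proj {M<..} x"] by simp
      also have "\<dots> \<le> e / 2 * norm x" using \<open>e > 0\<close> by (intro mult_left_mono norm_proj_le) auto
      finally show ?thesis .
    qed
    have "x = proj {..N} x + proj {N<..M} x + proj {M<..} x"
      by (rule c00_eqI) (auto simp: coord_add coord_proj M_def)
    then have "w (to_completion x) = w (to_completion (proj {..N} x))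
        + w (to_completion (proj {N<..M} x)) + w (to_completion (proj {M<..} x))"
      by (metis linear_add[OF lin])
    then show ?thesis using head mid tail by linarith
  qed
  then have "block_dominated L e N M w 1"
    unfolding block_dominated_def
    by (intro conjI exI[of _ "[{N<..M}]"]) (auto simp: M_def)
  then show ?thesis by blast
qed

lemma norm_dual_le:
  fixes w :: tsirelson_dual
  assumes "c \<ge> 0" "\<And>x. \<bar>w (to_completion x)\<bar> \<le> c * norm x"
  shows "norm w \<le> c"
proof (rule norm_blinfun_bound[OF assms(1)])
  fix t :: tsirelson
  obtain X where X: "(\<lambda>n. to_completion (X n)) \<longlonglongrightarrow> t" by (rule completion_approx)
  show "norm (w t) \<le> c * norm t"
  proof (rule LIMSEQ_le)
    show "(\<lambda>n. norm (w (to_completion (X n)))) \<longlonglongrightarrow> norm (w t)"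
      by (intro tendsto_norm blinfun.tendsto tendsto_const X)
    show "(\<lambda>n. c * norm (to_completion (X n))) \<longlonglongrightarrow> c * norm t"
      by (intro tendsto_intros X)
  qed (use assms(2) in simp)
qed

text \<open>
  The upper estimate for blocks in the dual space: \<open>n\<close> successive supports beyond \<open>n\<close> are admissible,
  so the norms of the \<open>n\<close> restrictions of \<open>x\<close> add up to at most \<open>2 * norm x\<close>. The bound on the
  sum of \<open>n\<close> functionals is therefore that of two of them, whatever \<open>n\<close> is.
\<close>

lemma norm_block_dominated_le:
  assumes "block_dominated L e N M w n" "n \<le> N" "L \<ge> 0" "e \<ge> 0"
  shows "norm w \<le> 2 * L + real n * e"
proof (rule norm_dual_le)
  show "2 * L + real n * e \<ge> 0" using assms by simp
  fix x
  obtain Es where Es: "length Es = n" "sorted_wrt (\<lambda>E F. Max E < Min F) Es"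
    "\<And>E. E \<in> set Es \<Longrightarrow> finite E \<and> E \<noteq> {} \<and> E \<subseteq> {N<..M}"
    "\<And>x. \<bar>w (to_completion x)\<bar> \<le> L * (\<Sum>E\<leftarrow>Es. norm (proj E x)) + real n * e * norm x"
    using assms(1) unfolding block_dominated_def by blast
  have "(\<Sum>E\<leftarrow>Es. norm (proj E x)) \<le> 2 * norm x"
  proof (cases "Es = []")
    case False
    have "Min (hd Es) \<in> {N<..M}"
      using Es(3)[of "hd Es"] False Min_in by (metis hd_in_set subsetD)
    then have "admissible Es"
      unfolding admissible_def using Es(1,2,3) False assms(2) by fastforce
    then show ?thesis by (rule admissible_sum_le_norm)
  qed simp
  then have "L * (\<Sum>E\<leftarrow>Es. norm (proj E x)) \<le> L * (2 * norm x)"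
    using assms(3) by (rule mult_left_mono)
  then show "\<bar>w (to_completion x)\<bar> \<le> (2 * L + real n * e) * norm x"
    using Es(4)[of x] by (simp add: algebra_simps)
qed

text \<open>
  Lists of length \<open>k\<close> form the Hamming cube \<open>\<nat>\<^sup>k\<close>, in which points that differ in one entry have
  distance \<open>1\<close>.
\<close>

definition hamming_lipschitz ::
    "nat \<Rightarrow> real \<Rightarrow> (nat list \<Rightarrow> 'a::real_normed_vector) \<Rightarrow> bool" where
  "hamming_lipschitz k L g \<longleftrightarrow> (\<forall>xs n n' ys. Suc (length xs + length ys) = k
     \<longrightarrow> norm (g (xs @ n # ys) - g (xs @ n' # ys)) \<le> L)"

lemma hamming_lipschitzD:
  "hamming_lipschitz k L g \<Longrightarrow> Suc (length xs + length ys) = k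
    \<Longrightarrow> norm (g (xs @ n # ys) - g (xs @ n' # ys)) \<le> L"
  unfolding hamming_lipschitz_def by blast

text \<open>
  Taking weak* limits in the last variable, then in the one before it, and so on down to a constant
  \<open>c\<close>, writes \<open>g ns - c\<close> as a telescoping sum of \<open>k\<close> differences. The \<open>i\<close>-th of them depends on the first
  \<open>i\<close> entries, has norm at most \<open>L\<close>, and tends weakly* to \<open>0\<close> in its last entry. Choosing the entries
  one after the other makes each difference nearly vanish on the coordinates that carry the previous
  ones. The constant \<open>c\<close> comes before \<open>N\<close> and \<open>R\<close>, so that it cancels between two points.
\<close>

lemma hamming_lipschitz_decomposition:
  fixes g :: "nat list \<Rightarrow> tsirelson_dual"
  assumes "hamming_lipschitz k L g" "e > 0"
  shows "\<exists>c. \<forall>N R. \<exists>ns M. length ns = k \<and> (\<forall>i\<in>set ns. R < i)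
    \<and> block_dominated L e N M (g ns - c) k"
  using assms(1)
proof (induction k arbitrary: g)
  case 0
  show ?case
  proof (intro exI allI)
    fix N show "length [] = 0 \<and> (\<forall>i\<in>set []. R < i) \<and> block_dominated L e N N (g [] - g []) 0"
      for R :: nat by (simp add: block_dominated_zero)
  qed
next
  case (Suc k)
  define g' where "g' ns = weak_star_limit (\<lambda>n. g (ns @ [n]))" for ns
  have last: "norm (g (ns @ [n]) - g (ns @ [m])) \<le> L" if "length ns = k" for ns n m
    using hamming_lipschitzD[OF Suc.prems, of ns "[]" n m] that by simp
  have Bseq_g: "Bseq (\<lambda>n. g (ns @ [n]))" if "length ns = k" for ns
  proof (rule BseqI')
    fix n show "norm (g (ns @ [n])) \<le> norm (g (ns @ [0])) + L"
      using last[OF that, of n 0] norm_triangle_sub[of "g (ns @ [n])" "g (ns @ [0])"] by linarith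
  qed
  have "hamming_lipschitz k L g'"
    unfolding hamming_lipschitz_def
  proof (intro allI impI)
    fix xs ys :: "nat list" and n n' :: nat assume len: "Suc (length xs + length ys) = k"
    show "norm (g' (xs @ n # ys) - g' (xs @ n' # ys)) \<le> L"
      unfolding g'_def
    proof (rule norm_weak_star_limit_diff_le)
      fix m show "norm (g ((xs @ n # ys) @ [m]) - g ((xs @ n' # ys) @ [m])) \<le> L"
        using hamming_lipschitzD[OF Suc.prems, of xs "ys @ [m]" n n'] len by simp
    qed (rule Bseq_g; use len in simp)+
  qed
  from Suc.IH[OF this] obtain c where c: "\<And>N R. \<exists>ns M. length ns = k \<and> (\<forall>i\<in>set ns. R < i)
    \<and> block_dominated L e N M (g' ns - c) k" by blast
  have "\<exists>ns M. length ns = Suc k \<and> (\<forall>i\<in>set ns. R < i)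
    \<and> block_dominated L e N M (g ns - c) (Suc k)" for N R
  proof -
    obtain ns M where ns: "length ns = k" "\<forall>i\<in>set ns. R < i" "block_dominated L e N M (g' ns - c) k"
      using c by blast
    define a where "a j n = g (ns @ [n]) (to_completion (unit_vec j))" for j n
    note B = Bseq_g[OF ns(1)]
    obtain n where n: "n \<ge> Suc R"
      "\<forall>f \<in> a ` {..M}. \<bar>f n - generalised_limit f\<bar> < e / (2 * real (Suc M))"
    proof (rule generalised_limit_approx[of "a ` {..M}" "e / (2 * real (Suc M))" "Suc R"])
      show "\<forall>f \<in> a ` {..M}. Bseq f"
        unfolding a_def using Bseq_blinfun_apply[OF B] by blast
    qed (use \<open>e > 0\<close> in auto)
    define d where "d = g (ns @ [n]) - g' ns"
    have "g' ns (to_completion (unit_vec j)) = generalised_limit (a j)" for j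
      unfolding g'_def a_def by (rule weak_star_limit_apply[OF B])
    then have "\<bar>d (to_completion (unit_vec j))\<bar> \<le> e / (2 * real (Suc M))" if "j \<le> M" for j
      using n(2) that by (force simp: d_def blinfun.diff_left a_def intro: less_imp_le)
    then have "(\<Sum>j\<le>M. \<bar>d (to_completion (unit_vec j))\<bar>) \<le> real (card {..M}) * (e / (2 * real (Suc M)))"
      by (intro sum_bounded_above) simp
    also have "\<dots> = e / 2" by (simp add: field_simps)
    finally have small: "(\<Sum>j\<le>M. \<bar>d (to_completion (unit_vec j))\<bar>) \<le> e / 2" .
    have "norm (weak_star_limit (\<lambda>_. g (ns @ [n])) - g' ns) \<le> L"
      unfolding g'_def using last[OF ns(1)] by (intro norm_weak_star_limit_diff_le B) simp_all
    then have "norm d \<le> L" by (simp add: d_def weak_star_limit_const)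
    from block_dominated_single[OF \<open>e > 0\<close> this small]
    obtain K where "block_dominated L e M K d 1" by blast
    from block_dominated_add[OF ns(3) this]
    have "block_dominated L e N K (g (ns @ [n]) - c) (Suc k)" by (simp add: d_def)
    then show ?thesis using ns n(1) by (intro exI[of _ "ns @ [n]"] exI[of _ K]) auto
  qed
  then show ?case by blast
qed

text \<open>
  The second point is chosen after the first so that the \<open>k\<close> blocks of one and the \<open>k\<close> negated blocks of the
  other form a single sequence of \<open>2 * k\<close> blocks, which starts beyond \<open>2 * k\<close>.
\<close>

theorem hamming_lipschitz_concentration:
  fixes g :: "nat list \<Rightarrow> tsirelson_dual"
  assumes g: "hamming_lipschitz k L g" and "L \<ge> 0" "\<delta> > 0"
  shows "\<exists>ns ms. length ns = k \<and> length ms = k \<and> (\<forall>i\<in>set ns. \<forall>j\<in>set ms. i < j)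
    \<and> norm (g ns - g ms) \<le> 2 * L + \<delta>"
proof -
  define e where "e = \<delta> / (2 * real k + 1)"
  have "e > 0" using \<open>\<delta> > 0\<close> by (simp add: e_def)
  obtain c where c: "\<forall>N R. \<exists>ns M. length ns = k \<and> (\<forall>i\<in>set ns. R < i)
    \<and> block_dominated L e N M (g ns - c) k"
    by (rule exE[OF hamming_lipschitz_decomposition[OF g \<open>e > 0\<close>]])
  obtain ns M where ns: "length ns = k" "block_dominated L e (k + k) M (g ns - c) k"
    using c[THEN spec, of "k + k", THEN spec, of 0] by blast
  obtain ms K where ms: "length ms = k" "\<forall>j\<in>set ms. Max (insert 0 (set ns)) < j"
    "block_dominated L e M K (g ms - c) k"
    using c[THEN spec, of M, THEN spec, of "Max (insert 0 (set ns))"] by blast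
  have "block_dominated L e (k + k) K ((g ns - c) + - (g ms - c)) (k + k)"
    by (rule block_dominated_add[OF ns(2) block_dominated_uminus[OF ms(3)]])
  then have "norm (g ns - g ms) \<le> 2 * L + real (k + k) * e"
    using norm_block_dominated_le[of L e "k + k" K _ "k + k"] \<open>L \<ge> 0\<close> \<open>e > 0\<close> by simp
  also have "real (k + k) * e \<le> \<delta>"
    using \<open>\<delta> > 0\<close> by (simp add: e_def field_simps)
  finally have "norm (g ns - g ms) \<le> 2 * L + \<delta>" by simp
  moreover have "\<forall>i\<in>set ns. \<forall>j\<in>set ms. i < j"
    using ms(2) by (meson List.finite_set Max_ge finite_insert insertI2 le_less_trans)
  ultimately show ?thesis using ns(1) ms(1) by blast
qed


section \<open>Obstruction to embeddings\<close>

text \<open>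
  A copy of the Hamming cube with edges of length at most \<open>a\<close> in which points \<open>ns < ms\<close> stay at distance
  at least \<open>b\<close>. It obstructs embeddings when \<open>b\<close> is large compared with \<open>a\<close>.
\<close>

definition hamming_copy ::
    "'a metric \<Rightarrow> nat \<Rightarrow> real \<Rightarrow> real \<Rightarrow> (nat list \<Rightarrow> 'a) \<Rightarrow> bool" where
  "hamming_copy X k a b h \<longleftrightarrow>
     (\<forall>ns. length ns = k \<longrightarrow> h ns \<in> mspace X) \<and>
     (\<forall>xs n n' ys. Suc (length xs + length ys) = k
        \<longrightarrow> mdist X (h (xs @ n # ys)) (h (xs @ n' # ys)) \<le> a) \<and>
     (\<forall>ns ms. length ns = k \<longrightarrow> length ms = k \<longrightarrow> (\<forall>i\<in>set ns. \<forall>j\<in>set ms. i < j)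
        \<longrightarrow> b \<le> mdist X (h ns) (h ms))"

lemma hamming_copy_submetric:
  assumes "hamming_copy X k a b h" "\<And>ns. length ns = k \<Longrightarrow> h ns \<in> S"
  shows "hamming_copy (submetric X S) k a b h"
  using assms unfolding hamming_copy_def by simp

text \<open>
  The image of the cube has edges of length at most the expansion modulus at \<open>a\<close>, so by concentration it contains
  two points \<open>ns < ms\<close> whose images are hardly more than twice that distance apart, while \<open>h ns\<close> and
  \<open>h ms\<close> are at least \<open>b\<close> apart. The dimension \<open>k\<close> does not enter.
\<close>

lemma compression_le_expansion:
  fixes f :: "'a \<Rightarrow> tsirelson_dual"
  assumes h: "hamming_copy X k a b h"
    and fin: "expansion_modulus X tsirelson_dual_metric f a < \<infinity>"
  shows "compression_modulus X tsirelson_dual_metric f b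
    \<le> 2 * expansion_modulus X tsirelson_dual_metric f a"
proof (rule ennreal_le_epsilon)
  fix \<delta> :: real assume "\<delta> > 0"
  define L where "L = enn2real (expansion_modulus X tsirelson_dual_metric f a)"
  have L: "expansion_modulus X tsirelson_dual_metric f a = ennreal L" "L \<ge> 0"
    using fin by (simp_all add: L_def)
  have "hamming_lipschitz k L (\<lambda>ns. f (h ns))"
    unfolding hamming_lipschitz_def
  proof (intro allI impI)
    fix xs ys :: "nat list" and n n' assume len: "Suc (length xs + length ys) = k"
    have "h (xs @ n # ys) \<in> mspace X" "h (xs @ n' # ys) \<in> mspace X"
      "mdist X (h (xs @ n # ys)) (h (xs @ n' # ys)) \<le> a"
      using h len unfolding hamming_copy_def by simp_all
    then have "ennreal (dist (f (h (xs @ n # ys))) (f (h (xs @ n' # ys))))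
        \<le> expansion_modulus X tsirelson_dual_metric f a"
      unfolding expansion_modulus_def mdist_euclidean_metric by (intro Sup_upper) blast
    then show "norm (f (h (xs @ n # ys)) - f (h (xs @ n' # ys))) \<le> L"
      using L by (simp add: dist_norm)
  qed
  from hamming_lipschitz_concentration[OF this \<open>L \<ge> 0\<close> \<open>\<delta> > 0\<close>]
  obtain ns ms where nm: "length ns = k" "length ms = k" "\<forall>i\<in>set ns. \<forall>j\<in>set ms. i < j"
    "norm (f (h ns) - f (h ms)) \<le> 2 * L + \<delta>" by (elim exE conjE) (rule that)
  have "h ns \<in> mspace X" "h ms \<in> mspace X" "b \<le> mdist X (h ns) (h ms)"
    using h nm(1-3) unfolding hamming_copy_def by simp_all
  then have "compression_modulus X tsirelson_dual_metric f b \<le> ennreal (dist (f (h ns)) (f (h ms)))"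
    unfolding compression_modulus_def mdist_euclidean_metric by (intro Inf_lower) blast
  also have "\<dots> \<le> ennreal (2 * L + \<delta>)" using nm(4) by (intro ennreal_leI) (simp add: dist_norm)
  also have "\<dots> = 2 * ennreal L + ennreal \<delta>"
    using \<open>L \<ge> 0\<close> \<open>\<delta> > 0\<close> by (simp add: ennreal_mult)
  finally show "compression_modulus X tsirelson_dual_metric f b
      \<le> 2 * expansion_modulus X tsirelson_dual_metric f a + ennreal \<delta>"
    by (simp add: L(1))
qed

lemma not_coarsely_embeds:
  assumes h: "\<And>k. k \<ge> 1 \<Longrightarrow> hamming_copy X k a (b k) (h k)"
    and "a > 0" and b: "filterlim b at_top sequentially"
  shows "\<not> coarsely_embeds X tsirelson_dual_metric"
proof
  assume "coarsely_embeds X tsirelson_dual_metric"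
  then obtain f where f: "coarse_embedding X tsirelson_dual_metric f"
    by (auto simp: coarsely_embeds_def)
  let ?\<rho> = "compression_modulus X tsirelson_dual_metric f"
  let ?\<omega> = "expansion_modulus X tsirelson_dual_metric f a"
  have fin: "?\<omega> < \<infinity>" using f \<open>a > 0\<close> by (simp add: coarse_embedding_def)
  then have "2 * ?\<omega> < \<infinity>" by (simp add: ennreal_mult_less_top)
  moreover have "((\<lambda>k. ?\<rho> (b k)) \<longlongrightarrow> \<infinity>) sequentially"
    using f b by (auto simp: coarse_embedding_def intro: filterlim_compose)
  ultimately have "\<forall>\<^sub>F k in sequentially. 2 * ?\<omega> < ?\<rho> (b k)"
    by (intro order_tendstoD(1))
  then have "\<forall>\<^sub>F k in sequentially. False"
    using eventually_ge_at_top[of 1]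
  proof eventually_elim
    case (elim k)
    show False using compression_le_expansion[OF h[OF elim(2)] fin] elim(1) by simp
  qed
  then show False by simp
qed

lemma not_uniformly_embeds:
  assumes h: "\<And>k. k \<ge> 1 \<Longrightarrow> hamming_copy X k (a k) b (h k)"
    and pos: "\<And>k. k \<ge> 1 \<Longrightarrow> a k > 0" and a: "a \<longlonglongrightarrow> 0" and "b > 0"
  shows "\<not> uniformly_embeds X tsirelson_dual_metric"
proof
  assume "uniformly_embeds X tsirelson_dual_metric"
  then obtain f where f: "uniform_embedding X tsirelson_dual_metric f"
    by (auto simp: uniformly_embeds_def)
  let ?\<rho> = "compression_modulus X tsirelson_dual_metric f b"
  let ?\<omega> = "expansion_modulus X tsirelson_dual_metric f"
  have "\<forall>\<^sub>F k in sequentially. a k \<in> {0<..} \<and> a k \<noteq> 0"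
    using eventually_ge_at_top[of 1] by (rule eventually_mono) (use pos in fastforce)
  then have "filterlim a (at_right 0) sequentially"
    unfolding filterlim_at using a by simp
  then have \<omega>: "(\<lambda>k. ?\<omega> (a k)) \<longlonglongrightarrow> 0"
    using f by (auto simp: uniform_embedding_def intro: filterlim_compose)
  have "\<forall>\<^sub>F k in sequentially. ?\<rho> \<le> 2 * ?\<omega> (a k)"
    using order_tendstoD(2)[OF \<omega> zero_less_one] eventually_ge_at_top[of 1]
  proof eventually_elim
    case (elim k)
    then have "?\<omega> (a k) < \<infinity>" by (metis ennreal_one_less_top infinity_ennreal_def less_trans zero_less_one)
    then show ?case using compression_le_expansion[OF h] elim(2) by blast
  qed
  moreover have "(\<lambda>k. 2 * ?\<omega> (a k)) \<longlonglongrightarrow> 2 * 0"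
    by (intro ennreal_tendsto_cmult \<omega>) simp
  ultimately have "?\<rho> \<le> 2 * 0"
    by (intro tendsto_le[OF sequentially_bot _ tendsto_const])
  moreover have "0 < ?\<rho>" using f \<open>b > 0\<close> unfolding uniform_embedding_def by blast
  ultimately show False by simp
qed

section \<open>Hamming cubes in the sequence spaces\<close>

text \<open>
  This is \<open>t\<close> times a sum of vectors \<open>s\<^sub>n = e\<^sub>0 + \<dots> + e\<^bsub>n - 1\<^esub>\<close> of the summing basis. Sums of
  distinct unit vectors would stay at distance at most \<open>t\<close> from each other in the sup-norm.
\<close>

definition c0_cube :: "real \<Rightarrow> nat list \<Rightarrow> nat \<Rightarrow> real" where
  "c0_cube t ns = (\<lambda>j. \<Sum>n\<leftarrow>ns. if j < n then t else 0)"

lemma c0_cube_bounds: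
  assumes "t \<ge> 0"
  shows "0 \<le> c0_cube t ns j" "c0_cube t ns j \<le> real (length ns) * t"
  using assms by (induction ns) (auto simp: c0_cube_def algebra_simps)

lemma c0_cube_eq_0: "\<forall>n\<in>set ns. n \<le> j \<Longrightarrow> c0_cube t ns j = 0"
  by (induction ns) (auto simp: c0_cube_def)

lemma c0_cube_eq_length: "\<forall>n\<in>set ns. j < n \<Longrightarrow> c0_cube t ns j = real (length ns) * t"
  by (induction ns) (auto simp: c0_cube_def algebra_simps)

lemma c0_cube_in_c0: "c0_cube t ns \<in> c0_space"
proof -
  have "\<forall>\<^sub>F j in sequentially. c0_cube t ns j = 0"
    using eventually_ge_at_top[of "Max (insert 0 (set ns))"]
    by (rule eventually_mono) (auto intro: c0_cube_eq_0)
  then show ?thesis unfolding c0_space_def by (simp add: tendsto_eventually)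
qed

lemma sup_norm_le: "(\<And>j. \<bar>x j\<bar> \<le> c) \<Longrightarrow> sup_norm x \<le> c"
  unfolding sup_norm_def by (rule cSUP_least) auto

text \<open>
  Between the largest entry of \<open>ns\<close> and the smallest entry of \<open>ms\<close> lies a coordinate at which all the
  summands for \<open>ms\<close> equal \<open>t\<close> and all those for \<open>ns\<close> vanish.
\<close>

lemma hamming_copy_c0:
  assumes "t \<ge> 0" "k \<ge> 1"
  shows "hamming_copy c0_metric k t (real k * t) (c0_cube t)"
  unfolding hamming_copy_def
proof (intro conjI allI impI)
  fix xs ys :: "nat list" and n n' :: nat
  show "mdist c0_metric (c0_cube t (xs @ n # ys)) (c0_cube t (xs @ n' # ys)) \<le> t"
    unfolding mdist_c0_metric[OF c0_cube_in_c0 c0_cube_in_c0]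
    by (rule sup_norm_le) (use \<open>t \<ge> 0\<close> in \<open>simp add: c0_cube_def\<close>)
next
  fix ns ms :: "nat list"
  assume len: "length ns = k" "length ms = k" and less: "\<forall>i\<in>set ns. \<forall>j\<in>set ms. i < j"
  define j where "j = Max (set ns)"
  have "set ns \<noteq> {}" using len \<open>k \<ge> 1\<close> by auto
  then have "j \<in> set ns" unfolding j_def by (intro Max_in) auto
  have "c0_cube t ns j = 0" by (rule c0_cube_eq_0) (simp add: j_def)
  moreover have "c0_cube t ms j = real k * t"
    using c0_cube_eq_length[of ms j t] less \<open>j \<in> set ns\<close> len by simp
  ultimately have "\<bar>c0_cube t ns j - c0_cube t ms j\<bar> = real k * t" using \<open>t \<ge> 0\<close> by simp
  then show "real k * t \<le> mdist c0_metric (c0_cube t ns) (c0_cube t ms)"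
    unfolding mdist_c0_metric[OF c0_cube_in_c0 c0_cube_in_c0]
    using abs_le_sup_norm[OF c0_diff[OF c0_cube_in_c0 c0_cube_in_c0]] by metis
qed (simp add: c0_cube_in_c0)

lemma c0_cube_in_ball:
  assumes "t \<ge> 0" "real (length ns) * t \<le> 1"
  shows "c0_cube t ns \<in> mcball_of c0_metric (\<lambda>_. 0) 1"
proof -
  have zero: "(\<lambda>_. 0) \<in> c0_space" by (simp add: c0_space_def)
  have "\<bar>0 - c0_cube t ns j\<bar> \<le> 1" for j
    using c0_cube_bounds[OF assms(1), of ns j] assms(2) by linarith
  then have "sup_norm (\<lambda>j. 0 - c0_cube t ns j) \<le> 1" by (rule sup_norm_le)
  then show ?thesis by (simp add: zero c0_cube_in_c0 mdist_c0_metric)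
qed

lemma lp_norm_constant_modulus:
  assumes "p \<ge> 1" "t \<ge> 0" "finite S" "\<And>j. \<bar>x j\<bar> = (if j \<in> S then t else 0)"
  shows "x \<in> lp_space p" "lp_norm p x = t * card S powr (1 / p)"
proof -
  have eq: "\<bar>x j\<bar> powr p = (if j \<in> S then t powr p else 0)" for j
    using assms(1,4) by simp
  have sums: "(\<lambda>j. \<bar>x j\<bar> powr p) sums (\<Sum>j\<in>S. t powr p)"
    unfolding eq using sums_If_finite_set[OF \<open>finite S\<close>, of "\<lambda>_. t powr p"] by simp
  then show "x \<in> lp_space p" by (simp add: lp_space_def sums_iff)
  have "lp_norm p x = (card S * t powr p) powr (1 / p)"
    using sums by (simp add: lp_norm_def sums_iff)
  also have "\<dots> = t * card S powr (1 / p)"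
    using assms(1,2) by (simp add: powr_mult powr_powr)
  finally show "lp_norm p x = t * card S powr (1 / p)" .
qed

text \<open>
  The position is encoded together with the entry, so that lists with repeated entries also have a
  support of full cardinality; the cube then lies in a ball of radius \<open>t * k powr (1 / p)\<close>.
\<close>

definition lp_cube_support :: "nat list \<Rightarrow> nat set" where
  "lp_cube_support ns = (\<lambda>i. prod_encode (i, ns ! i)) ` {..<length ns}"

definition lp_cube :: "real \<Rightarrow> nat list \<Rightarrow> nat \<Rightarrow> real" where
  "lp_cube t ns = (\<lambda>j. if j \<in> lp_cube_support ns then t else 0)"

lemma finite_lp_cube_support [simp]: "finite (lp_cube_support ns)"
  by (simp add: lp_cube_support_def)

lemma card_lp_cube_support: "card (lp_cube_support ns) = length ns"
  unfolding lp_cube_support_def by (subst card_image) (auto simp: inj_on_def)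

lemma lp_norm_lp_cube:
  assumes "p \<ge> 1" "t \<ge> 0"
  shows "lp_cube t ns \<in> lp_space p" "lp_norm p (lp_cube t ns) = t * length ns powr (1 / p)"
  using lp_norm_constant_modulus[OF assms, of "lp_cube_support ns" "lp_cube t ns"] assms
  by (auto simp: lp_cube_def card_lp_cube_support)

lemma mdist_lp_cube:
  assumes "p \<ge> 1" "t \<ge> 0"
  shows "mdist (lp_metric p) (lp_cube t ns) (lp_cube t ms)
    = t * card (sym_diff (lp_cube_support ns) (lp_cube_support ms)) powr (1 / p)"
  unfolding mdist_lp_metric[OF \<open>p \<ge> 1\<close>]
  by (rule lp_norm_constant_modulus(2)[OF assms]) (use \<open>t \<ge> 0\<close> in \<open>auto simp: lp_cube_def\<close>)

lemma hamming_copy_lp: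
  assumes "p \<ge> 1" "t \<ge> 0"
  shows "hamming_copy (lp_metric p) k (t * 2 powr (1 / p)) (t * (2 * k) powr (1 / p)) (lp_cube t)"
  unfolding hamming_copy_def
proof (intro conjI allI impI)
  fix xs ys :: "nat list" and n n' :: nat
  let ?S = "sym_diff (lp_cube_support (xs @ n # ys)) (lp_cube_support (xs @ n' # ys))"
  let ?P = "{prod_encode (length xs, n), prod_encode (length xs, n')}"
  have "?S \<subseteq> ?P"
  proof -
    have sub: "lp_cube_support (xs @ n # ys) \<subseteq> insert (prod_encode (length xs, n)) (lp_cube_support (xs @ n' # ys))"
      for n n'
    proof
      fix j assume "j \<in> lp_cube_support (xs @ n # ys)"
      then obtain i where i: "i < length (xs @ n # ys)" "j = prod_encode (i, (xs @ n # ys) ! i)"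
        unfolding lp_cube_support_def by blast
      show "j \<in> insert (prod_encode (length xs, n)) (lp_cube_support (xs @ n' # ys))"
      proof (cases "i = length xs")
        case True
        then show ?thesis using i(2) by simp
      next
        case False
        then have "(xs @ n # ys) ! i = (xs @ n' # ys) ! i" by (simp add: nth_append nth_Cons')
        then show ?thesis using i unfolding lp_cube_support_def by auto
      qed
    qed
    show ?thesis using sub[of n n'] sub[of n' n] by blast
  qed
  then have "card ?S \<le> card ?P" by (intro card_mono) auto
  also have "\<dots> \<le> 2" by (simp add: card_insert_if)
  finally have "real (card ?S) powr (1 / p) \<le> 2 powr (1 / p)"
    using \<open>p \<ge> 1\<close> by (intro powr_mono2) auto
  then show "mdist (lp_metric p) (lp_cube t (xs @ n # ys)) (lp_cube t (xs @ n' # ys))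
      \<le> t * 2 powr (1 / p)"
    unfolding mdist_lp_cube[OF assms] using \<open>t \<ge> 0\<close> by (rule mult_left_mono)
next
  fix ns ms :: "nat list"
  assume len: "length ns = k" "length ms = k" and less: "\<forall>i\<in>set ns. \<forall>j\<in>set ms. i < j"
  have disj: "lp_cube_support ns \<inter> lp_cube_support ms = {}"
  proof -
    have "ns ! i \<noteq> ms ! i" if "i < k" for i
      using less nth_mem[of i ns] nth_mem[of i ms] len that by (metis less_irrefl)
    then show ?thesis using len by (auto simp: lp_cube_support_def)
  qed
  then have "sym_diff (lp_cube_support ns) (lp_cube_support ms) = lp_cube_support ns \<union> lp_cube_support ms"
    by blast
  then have "card (sym_diff (lp_cube_support ns) (lp_cube_support ms)) = 2 * k"
    using disj len by (simp add: card_Un_disjoint card_lp_cube_support)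
  then show "t * (2 * real k) powr (1 / p) \<le> mdist (lp_metric p) (lp_cube t ns) (lp_cube t ms)"
    unfolding mdist_lp_cube[OF assms] by simp
qed (simp add: assms lp_norm_lp_cube)

lemma lp_cube_in_ball:
  assumes "p \<ge> 1" "t \<ge> 0" "t * length ns powr (1 / p) \<le> 1"
  shows "lp_cube t ns \<in> mcball_of (lp_metric p) (\<lambda>_. 0) 1"
proof -
  have "(\<lambda>_. 0) \<in> lp_space p" by (simp add: lp_space_def)
  moreover have "lp_norm p (\<lambda>j. 0 - lp_cube t ns j) = lp_norm p (lp_cube t ns)"
    by (simp add: lp_norm_def)
  ultimately show ?thesis using assms by (simp add: mdist_lp_metric lp_norm_lp_cube)
qed

theorem corollaryB:
  shows "\<not> coarsely_embeds c0_metric tsirelson_dual_metric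
    \<and> (\<forall>p::real. p \<ge> 1 \<longrightarrow>
        \<not> coarsely_embeds (lp_metric p) tsirelson_dual_metric)
    \<and> \<not> uniformly_embeds (submetric c0_metric (mcball_of c0_metric (\<lambda>_. 0) 1))
        tsirelson_dual_metric
    \<and> (\<forall>p::real. p \<ge> 1 \<longrightarrow>
        \<not> uniformly_embeds (submetric (lp_metric p) (mcball_of (lp_metric p) (\<lambda>_. 0) 1))
          tsirelson_dual_metric)"
proof (intro conjI allI impI)
  show "\<not> coarsely_embeds c0_metric tsirelson_dual_metric"
  proof (rule not_coarsely_embeds[where a = 1 and b = real])
    show "hamming_copy c0_metric k 1 (real k) (c0_cube 1)" if "k \<ge> 1" for k
      using hamming_copy_c0[of 1 k] that by simp
  qed (simp_all add: filterlim_real_sequentially)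
  show "\<not> uniformly_embeds (submetric c0_metric (mcball_of c0_metric (\<lambda>_. 0) 1)) tsirelson_dual_metric"
  proof (rule not_uniformly_embeds[where a = "\<lambda>k. 1 / real k" and b = 1])
    show "hamming_copy (submetric c0_metric (mcball_of c0_metric (\<lambda>_. 0) 1)) k (1 / real k) 1
        (c0_cube (1 / real k))" if "k \<ge> 1" for k
    proof (rule hamming_copy_submetric)
      show "hamming_copy c0_metric k (1 / real k) 1 (c0_cube (1 / real k))"
        using hamming_copy_c0[of "1 / real k" k] that by simp
      show "c0_cube (1 / real k) ns \<in> mcball_of c0_metric (\<lambda>_. 0) 1" if "length ns = k" for ns
        by (rule c0_cube_in_ball) (use that in simp_all)
    qed
    show "(\<lambda>k. 1 / real k) \<longlonglongrightarrow> 0" by (rule lim_1_over_n)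
  qed simp_all
next
  fix p :: real assume p: "p \<ge> 1"
  show "\<not> coarsely_embeds (lp_metric p) tsirelson_dual_metric"
  proof (rule not_coarsely_embeds[where a = "2 powr (1 / p)" and b = "\<lambda>k. (2 * real k) powr (1 / p)"])
    show "hamming_copy (lp_metric p) k (2 powr (1 / p)) ((2 * real k) powr (1 / p)) (lp_cube 1)" for k
      using hamming_copy_lp[OF p, of 1 k] by simp
    show "filterlim (\<lambda>k. (2 * real k) powr (1 / p)) at_top sequentially"
      using p by real_asymp
  qed simp
  let ?a = "\<lambda>k. real k powr (- 1 / p) * 2 powr (1 / p)"
  show "\<not> uniformly_embeds (submetric (lp_metric p) (mcball_of (lp_metric p) (\<lambda>_. 0) 1))
      tsirelson_dual_metric"
  proof (rule not_uniformly_embeds[where a = ?a and b = "2 powr (1 / p)"])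
    show "hamming_copy (submetric (lp_metric p) (mcball_of (lp_metric p) (\<lambda>_. 0) 1)) k (?a k)
        (2 powr (1 / p)) (lp_cube (real k powr (- 1 / p)))" if "k \<ge> 1" for k
    proof (rule hamming_copy_submetric)
      have unit: "real k powr (- 1 / p) * real k powr (1 / p) = 1"
        using that by (simp flip: powr_add)
      have "real k powr (- 1 / p) * (2 * real k) powr (1 / p) = 2 powr (1 / p)"
        unfolding powr_mult using unit by (metis mult.assoc mult.commute mult_1)
      then show "hamming_copy (lp_metric p) k (?a k) (2 powr (1 / p)) (lp_cube (real k powr (- 1 / p)))"
        using hamming_copy_lp[OF p, of "real k powr (- 1 / p)" k] by (simp only: powr_ge_zero)
      show "lp_cube (real k powr (- 1 / p)) ns \<in> mcball_of (lp_metric p) (\<lambda>_. 0) 1"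
        if "length ns = k" for ns
        using unit that by (intro lp_cube_in_ball p) simp_all
    qed
    show "?a \<longlonglongrightarrow> 0" using p by real_asymp
  qed simp_all
qed

end
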